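(* Let $X$ be a pointed CW-complex. The assignment $G\mapsto\mathrm{TC}(p_G)$, where $p_G\colon\widetilde X_G\to X$ is the base-point preserving covering projection corresponding to the subgroup $G\le\pi_1(X)$, is an increasing map from the lattice of subgroups of $\pi_1(X)$ to $\mathbb{N}\cup\{\infty\}$ (i.e. $G\le G'$ implies $\mathrm{TC}(p_G)\le\mathrm{TC}(p_{G'})$). Its minimal value is the topological complexity $\mathrm{TC}(p_{\{1\}})$ of the universal covering projection and its maximal value is $\mathrm{TC}(X)$.
   Context: All spaces are path-connected metric absolute neighbourhood retracts. For every subgroup $G\le\pi_1(X)$, $p_G\colon\widetilde X_G\to X$ denotes the unique (up to equivalence) connected base-point preserving covering projection with $\mathrm{Im}\,(p_G)_\sharp=G$, where $(p_G)_\sharp$ is the induced map on fundamental groups; in particular $p_{\pi_1(X)}=\mathrm{id}_X$ and $p_{\{1\}}$ is the universal covering projection. Let $I=[0,1]$ and let $X^I$ be the space of continuous paths in $X$ with the compact-open topology. For a continuous surjection $p\colon E\to B$, the sectional number $\mathrm{sec}(p)$ is the minimal integer $n$ for which there is an increasing sequence of open subsets $\emptyset=U_0\subseteq U_1\subseteq\cdots\subseteq U_n=B$ such that for each $i=1,\dots,n$ there is a continuous map $s\colon U_i-U_{i-1}\to E$ with $p(s(b))=b$ for all $b$; if no such $n$ exists, $\mathrm{sec}(p)=\infty$. For a continuous surjection $f\colon X\to Y$ between path-connected spaces, $\mathrm{TC}(f)=\mathrm{sec}(\pi_f)$, where $\pi_f\colon X^I\to X\times Y$, $\pi_f(\alpha)=(\alpha(0),f(\alpha(1)))$;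 and $\mathrm{TC}(X)=\mathrm{TC}(\mathrm{id}_X)$. *)

theory Defs
  imports "HOL-Analysis.Analysis" "HOL-Algebra.Group"
begin

section \<open>The standing class of spaces\<close>

text \<open>A metric ANR is a metrizable space which is a neighbourhood retract of every metrizable
  space containing it as a closed subspace. The test spaces \<open>Z\<close> range over one fixed type, since
  HOL cannot quantify over types inside a definition. This loses nothing: a metric space on \<open>'a\<close>
  embeds isometrically, as a closed subset of its convex hull, into the bounded functions
  \<open>'a \<Rightarrow> real\<close> (Kuratowski--Wojdyslawski), and being a neighbourhood retract of that
  convex set already implies the condition for all metrizable \<open>Z\<close> (Dugundji).\<close>

definition metric_ANR :: "'a topology \<Rightarrow> bool" where
  "metric_ANR X \<longleftrightarrow> metrizable_space X \<and>
     (\<forall>(Z :: ('a \<Rightarrow> real) topology) S.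
        metrizable_space Z \<and> closedin Z S \<and> X homeomorphic_space (subtopology Z S) \<longrightarrow>
        (\<exists>U. openin Z U \<and> S \<subseteq> U \<and> S retract_of_space (subtopology Z U)))"

definition unit_disc :: "nat \<Rightarrow> (nat \<Rightarrow> real) topology" where
  "unit_disc n = subtopology (Euclidean_space n) {x. (\<Sum>i<n. (x i)\<^sup>2) \<le> 1}"

definition open_unit_disc :: "nat \<Rightarrow> (nat \<Rightarrow> real) set" where
  "open_unit_disc n = {x \<in> topspace (unit_disc n). (\<Sum>i<n. (x i)\<^sup>2) < 1}"

definition unit_disc_boundary :: "nat \<Rightarrow> (nat \<Rightarrow> real) set" where
  "unit_disc_boundary n = {x \<in> topspace (unit_disc n). (\<Sum>i<n. (x i)\<^sup>2) = 1}"

text \<open>Whitehead's definition: a Hausdorff space partitioned into open cells, with characteristic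
  maps \<open>\<Phi> e\<close>, closure finiteness, and the weak topology. The set \<open>\<C>\<close> consists of the open
  cells themselves and \<open>d e\<close> is the dimension of the cell \<open>e\<close>.\<close>

definition CW_complex :: "'a topology \<Rightarrow> bool" where
  "CW_complex X \<longleftrightarrow> Hausdorff_space X \<and>
     (\<exists>(\<C> :: 'a set set) (d :: 'a set \<Rightarrow> nat) (\<Phi> :: 'a set \<Rightarrow> (nat \<Rightarrow> real) \<Rightarrow> 'a).
        \<Union>\<C> = topspace X \<and> pairwise disjnt \<C> \<and>
        (\<forall>e\<in>\<C>.
           continuous_map (unit_disc (d e)) X (\<Phi> e) \<and>
           homeomorphic_map (subtopology (unit_disc (d e)) (open_unit_disc (d e)))
                            (subtopology X e) (\<Phi> e) \<and>
           (\<exists>F. finite F \<and> F \<subseteq> {c \<in> \<C>. d c < d e} \<and>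
                \<Phi> e ` unit_disc_boundary (d e) \<subseteq> \<Union>F)) \<and>
        (\<forall>A. A \<subseteq> topspace X \<and>
             (\<forall>e\<in>\<C>. closedin (unit_disc (d e)) {x \<in> topspace (unit_disc (d e)). \<Phi> e x \<in> A}) \<longrightarrow>
             closedin X A))"

section \<open>Fundamental groups and coverings\<close>

text \<open>The library's path homotopies, path concatenation and covering spaces are
  tied to subsets of a topological type; the following are their counterparts for abstract
  topologies. As for \<^const>\<open>pathin\<close>, values of a path outside \<open>{0..1}\<close> are irrelevant.\<close>

definition path_homotopic :: "'a topology \<Rightarrow> (real \<Rightarrow> 'a) \<Rightarrow> (real \<Rightarrow> 'a) \<Rightarrow> bool" where
  "path_homotopic X \<alpha> \<beta> \<longleftrightarrow>
     homotopic_with (\<lambda>\<gamma>. \<gamma> 0 = \<alpha> 0 \<and> \<gamma> 1 = \<alpha> 1) (top_of_set {0..1}) X \<alpha> \<beta>"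

definition path_concat :: "(real \<Rightarrow> 'a) \<Rightarrow> (real \<Rightarrow> 'a) \<Rightarrow> real \<Rightarrow> 'a" where
  "path_concat \<alpha> \<beta> = (\<lambda>t. if t \<le> 1/2 then \<alpha> (2 * t) else \<beta> (2 * t - 1))"

definition loops_at :: "'a topology \<Rightarrow> 'a \<Rightarrow> (real \<Rightarrow> 'a) set" where
  "loops_at X x0 = {\<alpha>. pathin X \<alpha> \<and> \<alpha> 0 = x0 \<and> \<alpha> 1 = x0}"

definition path_class :: "'a topology \<Rightarrow> (real \<Rightarrow> 'a) \<Rightarrow> (real \<Rightarrow> 'a) set" where
  "path_class X \<alpha> = {\<beta>. path_homotopic X \<alpha> \<beta>}"

text \<open>Operations on homotopy classes are given by the union of the classes obtained from all
  representatives, which avoids a choice of representatives.\<close>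

definition fundamental_group :: "'a topology \<Rightarrow> 'a \<Rightarrow> (real \<Rightarrow> 'a) set monoid" where
  "fundamental_group X x0 =
     \<lparr>carrier = path_class X ` loops_at X x0,
      mult = (\<lambda>A B. \<Union>\<alpha>\<in>A. \<Union>\<beta>\<in>B. path_class X (path_concat \<alpha> \<beta>)),
      one = path_class X (\<lambda>_. x0)\<rparr>"

definition induced_map ::
    "'b topology \<Rightarrow> ('a \<Rightarrow> 'b) \<Rightarrow> (real \<Rightarrow> 'a) set \<Rightarrow> (real \<Rightarrow> 'b) set" where
  "induced_map Y f A = (\<Union>\<alpha>\<in>A. path_class Y (f \<circ> \<alpha>))"

definition covering_projection :: "'e topology \<Rightarrow> ('e \<Rightarrow> 'a) \<Rightarrow> 'a topology \<Rightarrow> bool" where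
  "covering_projection E p X \<longleftrightarrow>
     continuous_map E X p \<and> p ` topspace E = topspace X \<and>
     (\<forall>x \<in> topspace X. \<exists>T. x \<in> T \<and> openin X T \<and>
        (\<exists>\<V>. \<Union>\<V> = {e \<in> topspace E. p e \<in> T} \<and>
             (\<forall>V\<in>\<V>. openin E V) \<and>
             pairwise disjnt \<V> \<and>
             (\<forall>V\<in>\<V>. homeomorphic_map (subtopology E V) (subtopology X T) p)))"

text \<open>\<open>(E, e0)\<close> with \<open>p\<close> is a connected base-point preserving covering of \<open>(X, x0)\<close>
  corresponding to the subgroup \<open>G\<close> of the fundamental group.\<close>

definition covering_for_subgroup ::
    "'e topology \<Rightarrow> 'e \<Rightarrow> ('e \<Rightarrow> 'a) \<Rightarrow> 'a topology \<Rightarrow> 'a \<Rightarrow> (real \<Rightarrow> 'a) set set \<Rightarrow> bool" where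
  "covering_for_subgroup E e0 p X x0 G \<longleftrightarrow>
     connected_space E \<and> e0 \<in> topspace E \<and>
     covering_projection E p X \<and> p e0 = x0 \<and>
     induced_map X p ` carrier (fundamental_group E e0) = G"

section \<open>Sectional number and topological complexity\<close>

text \<open>The infimum of the empty set of extended naturals is \<open>\<infinity>\<close>.\<close>

definition sectional_number :: "'e topology \<Rightarrow> ('e \<Rightarrow> 'b) \<Rightarrow> 'b topology \<Rightarrow> enat" where
  "sectional_number E p B =
     Inf {enat n | n. \<exists>U :: nat \<Rightarrow> 'b set.
            U 0 = {} \<and> U n = topspace B \<and>
            (\<forall>i\<le>n. openin B (U i)) \<and>
            (\<forall>i<n. U i \<subseteq> U (Suc i)) \<and>
            (\<forall>i\<in>{1..n}. \<exists>s. continuous_map (subtopology B (U i - U (i - 1))) E s \<and>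
                           (\<forall>b \<in> U i - U (i - 1). p (s b) = b))}"

text \<open>The space of paths with the compact-open topology. Paths are extensional functions,
  so that distinct elements are distinct maps on \<open>{0..1}\<close>. The choice \<open>K = {}\<close> shows
  that all paths belong to the space.\<close>

definition path_space :: "'a topology \<Rightarrow> (real \<Rightarrow> 'a) topology" where
  "path_space X = topology_generated_by
     {{\<alpha> \<in> extensional {0..1}. pathin X \<alpha> \<and> \<alpha> ` K \<subseteq> U} | K U.
        compact K \<and> K \<subseteq> {0..1} \<and> openin X U}"

definition TC_map :: "'a topology \<Rightarrow> ('a \<Rightarrow> 'b) \<Rightarrow> 'b topology \<Rightarrow> enat" where
  "TC_map X f Y = sectional_number (path_space X) (\<lambda>\<alpha>. (\<alpha> 0, f (\<alpha> 1))) (prod_topology X Y)"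

definition TC :: "'a topology \<Rightarrow> enat" where
  "TC X = TC_map X id X"

end

theory Submission
  imports Defs
begin

text \<open>If \<open>G \<le> H\<close>, the lifting criterion gives \<open>q : E\<^sub>G \<rightarrow> E\<^sub>H\<close> over \<open>X\<close>. A motion planner for
  \<open>p\<^sub>H\<close> sends \<open>(q(e), x)\<close> to a path in \<open>E\<^sub>H\<close>; its projection to \<open>X\<close> starts at \<open>p\<^sub>G(e)\<close> and ends at
  \<open>x\<close>, and lifting it along \<open>p\<^sub>G\<close> from \<open>e\<close> gives a motion planner for \<open>p\<^sub>G\<close> on the preimages of the
  same open sets; it is continuous because homotopies parametrised by arbitrary spaces lift to
  coverings. The identity of \<open>X\<close> is a covering for the whole fundamental group, so the same
  comparison in both directions identifies the maximum with \<open>TC(X)\<close>. The lifting criterion needs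
  \<open>X\<close> to be locally path connected: it is a retract of an open subset of a convex set of functions.\<close>

section \<open>Absolute neighbourhood retracts are locally path connected\<close>

text \<open>A planner for a covering takes its start in the total space but its target in
  \<open>X\<close>, so a lifted path may end anywhere in the fibre over the target. This is why a
  continuous map of total spaces over \<open>X\<close> is enough to compare two coverings. The
  pieces on which sections are given are differences of open sets and may be disconnected or locally
  wild. Continuity of the lifted planner therefore rests on homotopy lifting over an arbitrary
  parameter space, where uniqueness of lifts is only applied along the vertical intervals {z} x
  [0,1]. For local path connectedness, \<open>metric_ANR\<close> tests against spaces carried by
  functions \<open>'a \<Rightarrow> real\<close>. The ambient space must live in that type, its
  balls must be path connected, and the image of \<open>X\<close> must be closed in it. These three
  demands dictate the Kuratowski functions and the lower bound that cuts out the convex set. The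
  coverings have points in \<open>'b\<close> but \<open>X\<close> has points in \<open>'a\<close>,
  so the comparison lemmas relate total spaces of two unrelated types; only then can the identity of
  \<open>X\<close> take part.\<close>

text \<open>The truncation at \<open>1\<close> makes the supremum finite for arbitrary functions, so that this is a
  metric on any set of functions; it has no effect on functions with values in \<open>[0, 1]\<close>.\<close>

definition sup_dist :: "('a \<Rightarrow> real) \<Rightarrow> ('a \<Rightarrow> real) \<Rightarrow> real" where
  "sup_dist f g = (SUP y. min 1 \<bar>f y - g y\<bar>)"

lemma le_sup_dist: "min 1 \<bar>f y - g y\<bar> \<le> sup_dist f g"
  unfolding sup_dist_def by (intro cSUP_upper bdd_aboveI[of _ 1]) auto

lemma sup_dist_le: "(\<And>y. min 1 \<bar>f y - g y\<bar> \<le> B) \<Longrightarrow> sup_dist f g \<le> B"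
  unfolding sup_dist_def by (intro cSUP_least) auto

lemma Metric_space_sup_dist: "Metric_space Z sup_dist"
proof
  fix f g :: "'a \<Rightarrow> real"
  have "0 \<le> min 1 \<bar>f undefined - g undefined\<bar>" by simp
  then show "0 \<le> sup_dist f g"
    using le_sup_dist by (rule order_trans)
  show "sup_dist f g = sup_dist g f"
    by (simp add: sup_dist_def abs_minus_commute)
next
  fix f g :: "'a \<Rightarrow> real"
  show "(sup_dist f g = 0) = (f = g)"
  proof
    assume "sup_dist f g = 0"
    then have "min 1 \<bar>f y - g y\<bar> \<le> 0" for y
      using le_sup_dist[of f y g] by simp
    then show "f = g" by (intro ext) (smt (verit))
  qed (simp add: sup_dist_def)
next
  fix f g h :: "'a \<Rightarrow> real"
  have "min 1 \<bar>f y - h y\<bar> \<le> sup_dist f g + sup_dist g h" for y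
    using le_sup_dist[of f y g] le_sup_dist[of g y h] by linarith
  then show "sup_dist f h \<le> sup_dist f g + sup_dist g h"
    by (rule sup_dist_le)
qed

definition segment_map :: "('a \<Rightarrow> real) \<Rightarrow> ('a \<Rightarrow> real) \<Rightarrow> real \<Rightarrow> 'a \<Rightarrow> real" where
  "segment_map f g t = (\<lambda>y. (1 - t) * f y + t * g y)"

text \<open>Balls are path connected: at time t the segment from the centre \<open>f\<close> to
  \<open>g\<close> is at distance at most t * \<open>sup_dist f g\<close> from \<open>f\<close>, so
  it stays in every ball about \<open>f\<close> that contains \<open>g\<close>. This scaling uses
  values in [0, 1], where the truncation in \<open>sup_dist\<close> does nothing.\<close>

lemma locally_path_connected_convex_functions:
  assumes unit: "\<And>f y. f \<in> Z \<Longrightarrow> 0 \<le> f y \<and> f y \<le> 1"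
    and conv: "\<And>f g t. \<lbrakk>f \<in> Z; g \<in> Z; 0 \<le> t; t \<le> 1\<rbrakk> \<Longrightarrow> segment_map f g t \<in> Z"
  shows "locally_path_connected_space (Metric_space.mtopology Z sup_dist)"
proof -
  interpret Metric_space Z sup_dist by (rule Metric_space_sup_dist)
  have pc: "path_connectedin mtopology (mball f r)" for f r
  proof -
    have seg: "\<exists>\<gamma>. pathin mtopology \<gamma> \<and> \<gamma> \<in> {0..1} \<rightarrow> mball f r \<and> \<gamma> 0 = f \<and> \<gamma> 1 = g"
      if g: "g \<in> mball f r" for g
    proof -
      have fZ: "f \<in> Z" "g \<in> Z" "sup_dist f g < r" using g by auto
      have d1: "\<bar>f y - g y\<bar> \<le> sup_dist f g" for y
      proof -
        have "\<bar>f y - g y\<bar> \<le> 1" using unit[OF fZ(1), of y] unit[OF fZ(2), of y] by linarith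
        then show ?thesis using le_sup_dist[of f y g] by simp
      qed
      have dseg: "sup_dist (segment_map f g s) (segment_map f g t) \<le> \<bar>s - t\<bar> * sup_dist f g" for s t
      proof (rule sup_dist_le)
        fix y
        have "\<bar>segment_map f g s y - segment_map f g t y\<bar> = \<bar>(t - s) * (f y - g y)\<bar>"
          by (simp add: segment_map_def algebra_simps)
        also have "\<dots> \<le> \<bar>s - t\<bar> * sup_dist f g"
          using d1 by (simp add: abs_mult abs_minus_commute mult_left_mono)
        finally show "min 1 \<bar>segment_map f g s y - segment_map f g t y\<bar> \<le> \<bar>s - t\<bar> * sup_dist f g"
          by simp
      qed
      have segZ: "segment_map f g t \<in> Z" if "t \<in> {0..1}" for t
        using conv fZ that by auto
      have seg01: "segment_map f g 0 = f" "segment_map f g 1 = g"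
        by (auto simp: segment_map_def)
      have "segment_map f g t \<in> mball f r" if t: "t \<in> {0..1}" for t
      proof -
        have "sup_dist f (segment_map f g t) \<le> \<bar>0 - t\<bar> * sup_dist f g"
          using dseg[of 0 t] seg01 by simp
        also have "\<dots> \<le> 1 * sup_dist f g"
          using t by (intro mult_right_mono) auto
        finally show ?thesis using segZ[OF t] fZ by simp
      qed
      moreover have "pathin mtopology (segment_map f g)"
      proof -
        have "\<exists>\<delta>>0. \<forall>s\<in>{0..1}. \<bar>s - t\<bar> < \<delta> \<longrightarrow> sup_dist (segment_map f g t) (segment_map f g s) < e"
          if "0 < e" for e t
        proof (intro exI conjI ballI impI)
          \<comment> \<open>The segment is Lipschitz with constant \<open>sup_dist f g\<close>;
            adding 1 keeps the quotient meaningful when \<open>f = g\<close>.\<close>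
          show "0 < e / (sup_dist f g + 1)" using that by (simp add: add_nonneg_pos)
          fix s assume s: "\<bar>s - t\<bar> < e / (sup_dist f g + 1)"
          have "sup_dist (segment_map f g t) (segment_map f g s) \<le> \<bar>s - t\<bar> * sup_dist f g"
            using dseg[of t s] by (simp add: abs_minus_commute)
          also have "\<dots> \<le> \<bar>s - t\<bar> * (sup_dist f g + 1)"
            by (intro mult_left_mono) auto
          also have "\<dots> < e" using s by (simp add: add_nonneg_pos pos_less_divide_eq)
          finally show "sup_dist (segment_map f g t) (segment_map f g s) < e" .
        qed
        note cont = this
        show ?thesis
          unfolding pathin_def continuous_map_def
        proof (intro conjI allI impI)
          show "segment_map f g \<in> topspace (top_of_set {0..1}) \<rightarrow> topspace mtopology"
            using segZ by auto
          fix U assume U: "openin mtopology U"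
          show "openin (top_of_set {0..1}) {t \<in> topspace (top_of_set {0..1}). segment_map f g t \<in> U}"
            unfolding openin_euclidean_subtopology_iff
          proof (intro conjI ballI)
            fix t assume "t \<in> {t \<in> topspace (top_of_set {0..1}). segment_map f g t \<in> U}"
            then have t: "t \<in> {0..1}" "segment_map f g t \<in> U" by auto
            then obtain e where e: "e > 0" "mball (segment_map f g t) e \<subseteq> U"
              using U openin_mtopology by blast
            obtain \<delta> where "\<delta> > 0" and \<delta>: "\<forall>s\<in>{0..1}. \<bar>s - t\<bar> < \<delta> \<longrightarrow> sup_dist (segment_map f g t) (segment_map f g s) < e"
              using cont[OF e(1)] by blast
            then show "\<exists>e>0. \<forall>x'\<in>{0..1}. dist x' t < e \<longrightarrow> x' \<in> {t \<in> topspace (top_of_set {0..1}). segment_map f g t \<in> U}"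
              using e segZ t by (auto intro!: exI[of _ \<delta>] simp: dist_real_def subset_iff)
          qed auto
        qed
      qed
      ultimately show ?thesis using seg01 by blast
    qed
    have centre: "path_component_of (subtopology mtopology (mball f r)) f g" if "g \<in> mball f r" for g
      using seg[OF that] unfolding path_component_of_def pathin_subtopology by (auto simp: Pi_iff)
    have "path_component_of (subtopology mtopology (mball f r)) x y"
      if "x \<in> mball f r" "y \<in> mball f r" for x y
      using path_component_of_trans[OF path_component_of_sym[OF centre[OF that(1)]] centre[OF that(2)]] .
    then show ?thesis
      unfolding path_connectedin_def path_connected_space_iff_path_component by auto
  qed
  show ?thesis
    unfolding locally_path_connected_space
  proof clarify
    fix V f assume V: "openin mtopology V" "f \<in> V"
    then obtain r where "r > 0" "mball f r \<subseteq> V" "f \<in> Z" by (metis openin_mtopology subsetD)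
    then show "\<exists>U. openin mtopology U \<and> path_connectedin mtopology U \<and> f \<in> U \<and> U \<subseteq> V"
      using pc by (intro exI[of _ "mball f r"]) auto
  qed
qed

text \<open>The Kuratowski embedding \<open>x \<mapsto> d(x, \<cdot>)\<close> for a metric bounded by \<open>1\<close>. Its image is closed in
  the convex set of functions bounded below by some positive multiple of some \<open>d(x, \<cdot>)\<close>: a limit
  \<open>g\<close> of the \<open>d(y\<^sub>n, \<cdot>)\<close> satisfies \<open>g(y\<^sub>n) \<rightarrow> 0\<close>, so \<open>y\<^sub>n \<rightarrow> x\<close>.\<close>

lemma metric_ANR_imp_locally_path_connected:
  fixes X :: "'a topology"
  assumes "metric_ANR X"
  shows "locally_path_connected_space X"
proof -
  obtain M d0 where "Metric_space M d0" and X0: "X = Metric_space.mtopology M d0"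
    using assms by (auto simp: metric_ANR_def metrizable_space_def)
  \<comment> \<open>Capping keeps the topology and brings the functions d(x, .) into [0, 1].\<close>
  define d where "d = Metric_space.capped_dist d0 1"
  interpret d: Metric_space M d
    unfolding d_def by (rule Metric_space.capped_dist) fact
  have X: "X = d.mtopology"
    using X0 \<open>Metric_space M d0\<close> by (simp add: d_def Metric_space.mtopology_capped_metric)
  have d1: "d x y \<le> 1" for x y
    using \<open>Metric_space M d0\<close> by (simp add: d_def Metric_space.capped_dist_def)
  \<comment> \<open>The triangle inequality is only available on \<open>M\<close>. The value 0
    elsewhere makes the supremum over the whole type see points of \<open>M\<close> only.\<close>
  define k where "k = (\<lambda>x y. if y \<in> M then d x y else 0)"
  define Z where "Z = {g. (\<forall>y. 0 \<le> g y \<and> g y \<le> 1) \<and> (\<exists>x\<in>M. \<exists>c>0. \<forall>y\<in>M. c * d x y \<le> g y)}"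
  interpret Z: Metric_space Z sup_dist by (rule Metric_space_sup_dist)
  have kZ: "k x \<in> Z" if "x \<in> M" for x
    unfolding Z_def using that d1 by (auto simp: k_def intro!: bexI[of _ x] exI[of _ 1])
  have convex: "segment_map f g t \<in> Z" if f: "f \<in> Z" and g: "g \<in> Z" and t: "0 \<le> t" "t \<le> 1" for f g t
  proof -
    have "0 \<le> segment_map f g t y \<and> segment_map f g t y \<le> 1" for y
    proof -
      have b: "0 \<le> f y" "f y \<le> 1" "0 \<le> g y" "g y \<le> 1" using f g by (auto simp: Z_def)
      have "(1 - t) * f y + t * g y \<le> (1 - t) * 1 + t * 1"
        using b t by (intro add_mono mult_left_mono) auto
      then show ?thesis using b t by (simp add: segment_map_def)
    qed
    moreover have "\<exists>x\<in>M. \<exists>c>0. \<forall>y\<in>M. c * d x y \<le> segment_map f g t y"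
    \<comment> \<open>For t < 1 the lower bound of \<open>f\<close> survives with the constant (1 -
      t) * c, because the other summand is nonnegative. At t = 1 this constant vanishes and the
      bound of \<open>g\<close> takes over.\<close>
    proof (cases "t = 1")
      case True
      then show ?thesis using g by (auto simp: Z_def segment_map_def)
    next
      case False
      obtain x c where xc: "x \<in> M" "c > 0" "\<forall>y\<in>M. c * d x y \<le> f y"
        using f by (auto simp: Z_def)
      have "((1 - t) * c) * d x y \<le> segment_map f g t y" if "y \<in> M" for y
      proof -
        have "(1 - t) * (c * d x y) \<le> (1 - t) * f y"
          using xc that t by (intro mult_left_mono) auto
        moreover have "0 \<le> t * g y" using g t by (simp add: Z_def)
        ultimately show ?thesis by (simp add: segment_map_def mult.assoc)
      qed
      moreover have "(1 - t) * c > 0" using xc t False by simp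
      ultimately show ?thesis using xc(1) by blast
    qed
    ultimately show ?thesis by (simp add: Z_def)
  qed
  have lpc: "locally_path_connected_space Z.mtopology"
    using convex by (intro locally_path_connected_convex_functions) (auto simp: Z_def)
  have iso: "sup_dist (k x) (k y) = d x y" if xy: "x \<in> M" "y \<in> M" for x y
  proof (rule antisym)
    have "\<bar>d x z - d y z\<bar> \<le> d x y" if "z \<in> M" for z
      using d.triangle[OF xy that] d.triangle[OF xy(2,1) that] d.commute[of x y] by linarith
    then show "sup_dist (k x) (k y) \<le> d x y"
      by (intro sup_dist_le) (auto simp: k_def min.coboundedI2)
    have "min 1 \<bar>k x y - k y y\<bar> = d x y" using xy d1 by (simp add: k_def)
    then show "d x y \<le> sup_dist (k x) (k y)"
      using le_sup_dist[of "k x" y "k y"] by simp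
  qed
  have clo: "closedin Z.mtopology (k ` M)"
    unfolding Z.closedin_metric
  proof (intro conjI allI impI)
    show "k ` M \<subseteq> Z" using kZ by auto
    fix g assume g: "g \<in> Z - k ` M"
    then obtain x c where xc: "x \<in> M" "c > 0" "\<And>y. y \<in> M \<Longrightarrow> c * d x y \<le> g y"
      by (auto simp: Z_def)
    have "sup_dist (k x) g > 0" using g xc kZ by (metis DiffE Z.mdist_pos_less imageI)
    \<comment> \<open>Write D for \<open>sup_dist (k x) g\<close>. If some \<open>k y\<close> were
      within r of \<open>g\<close>, then c * d(x, y) \<le> g(y) < r, and D \<le> d(x, y) + r would
      give c * D < (c + 1) * r; the factor c / (c + 1) excludes this. The bound 1 lets g(y) < r be
      read off from the truncated distance.\<close>
    define r where "r = min 1 (c / (c + 1) * sup_dist (k x) g)"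
    have "r > 0" using \<open>c > 0\<close> \<open>sup_dist (k x) g > 0\<close> by (simp add: r_def)
    moreover have "disjnt (k ` M) (Z.mball g r)"
    proof (rule ccontr)
      assume "\<not> ?thesis"
      then obtain y where y: "y \<in> M" "sup_dist g (k y) < r" by (auto simp: disjnt_iff)
      have "min 1 \<bar>g y - k y y\<bar> < r" using le_sup_dist[of g y "k y"] y by linarith
      then have "g y < r" using y by (auto simp: k_def r_def)
      then have "c * d x y < r" using xc y by fastforce
      moreover have "sup_dist (k x) g \<le> d x y + sup_dist g (k y)"
        using Z.triangle[of "k x" "k y" g] kZ xc y g iso Z.commute by auto
      ultimately have "c * sup_dist (k x) g < r + c * r"
      proof -
        assume "sup_dist (k x) g \<le> d x y + sup_dist g (k y)"
        then have "c * sup_dist (k x) g \<le> c * (d x y + r)"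
          using y(2) \<open>c > 0\<close> by (intro mult_left_mono) auto
        then show ?thesis using \<open>c * d x y < r\<close> by (simp add: distrib_left)
      qed
      moreover have "r \<le> c / (c + 1) * sup_dist (k x) g" by (simp add: r_def)
      then have "(c + 1) * r \<le> c * sup_dist (k x) g"
        using \<open>c > 0\<close> by (simp add: field_simps)
      ultimately show False by (simp add: algebra_simps)
    qed
    ultimately show "\<exists>r>0. disjnt (k ` M) (Z.mball g r)" by blast
  qed
  have hom: "X homeomorphic_space subtopology Z.mtopology (k ` M)"
  proof -
    interpret Metric_space12 M d Z sup_dist ..
    show ?thesis
      using embedding_map_imp_homeomorphic_space[OF isometry_imp_embedding_map[of k]] kZ iso
      by (auto simp: X)
  qed
  obtain U where U: "openin Z.mtopology U" "k ` M \<subseteq> U" "k ` M retract_of_space (subtopology Z.mtopology U)"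
    using assms[unfolded metric_ANR_def, THEN conjunct2, rule_format, of Z.mtopology "k ` M"]
      clo hom Z.metrizable_space_mtopology by auto
  have "locally_path_connected_space (subtopology Z.mtopology U)"
    by (rule locally_path_connected_space_open_subset[OF lpc U(1)])
  then have "locally_path_connected_space (subtopology (subtopology Z.mtopology U) (k ` M))"
    using U(3) locally_path_connected_space_retraction_map_image[of "subtopology Z.mtopology U"]
    by (auto simp: retract_of_space_retraction_maps retraction_map_def)
  then have "locally_path_connected_space (subtopology Z.mtopology (k ` M))"
    using U(2) by (simp add: subtopology_subtopology inf.absorb2)
  then show ?thesis
    using hom homeomorphic_locally_path_connected_space by blast
qed

section \<open>Lifting paths and homotopies to coverings\<close>

abbreviation unit_interval :: "real topology" where
  "unit_interval \<equiv> top_of_set {0..1}"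

section \<open>Sheets, local sections and uniqueness of lifts\<close>

lemma covering_sheets:
  assumes "covering_projection E p X" "x \<in> topspace X"
  obtains T \<V> \<sigma> where "x \<in> T" "openin X T"
    "\<Union>\<V> = {e \<in> topspace E. p e \<in> T}" "\<And>V. V \<in> \<V> \<Longrightarrow> openin E V" "pairwise disjnt \<V>"
    "\<And>V. V \<in> \<V> \<Longrightarrow> homeomorphic_maps (subtopology E V) (subtopology X T) p (\<sigma> V)"
proof -
  obtain T \<V> where T: "x \<in> T" "openin X T" "\<Union>\<V> = {e \<in> topspace E. p e \<in> T}"
    "\<forall>V\<in>\<V>. openin E V" "pairwise disjnt \<V>"
    and hom: "\<forall>V\<in>\<V>. homeomorphic_map (subtopology E V) (subtopology X T) p"
    using assms unfolding covering_projection_def by meson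
  from hom obtain \<sigma> where
    "\<And>V. V \<in> \<V> \<Longrightarrow> homeomorphic_maps (subtopology E V) (subtopology X T) p (\<sigma> V)"
    unfolding homeomorphic_map_maps by metis
  then show thesis
    using T by (intro that[of T \<V> \<sigma>]) auto
qed

lemma covering_local_section:
  assumes cov: "covering_projection E p X" and e: "e \<in> topspace E"
  obtains T V \<sigma> where "openin X T" "p e \<in> T" "openin E V" "e \<in> V" "p ` V \<subseteq> T"
    "continuous_map (subtopology X T) (subtopology E V) \<sigma>"
    "\<And>x. x \<in> T \<Longrightarrow> p (\<sigma> x) = x" "\<And>v. v \<in> V \<Longrightarrow> \<sigma> (p v) = v"
    "homeomorphic_map (subtopology E V) (subtopology X T) p"
proof -
  have "p e \<in> topspace X" using assms by (auto simp: covering_projection_def)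
  obtain T \<V> \<sigma> where T: "p e \<in> T" "openin X T"
    and V: "\<Union>\<V> = {e \<in> topspace E. p e \<in> T}" "\<And>V. V \<in> \<V> \<Longrightarrow> openin E V" "pairwise disjnt \<V>"
    and hom: "\<And>V. V \<in> \<V> \<Longrightarrow> homeomorphic_maps (subtopology E V) (subtopology X T) p (\<sigma> V)"
    by (rule covering_sheets[OF cov \<open>p e \<in> topspace X\<close>]) (rule that)
  obtain V where "V \<in> \<V>" "e \<in> V" using V(1) e T(1) by blast
  show thesis
  proof (rule that[OF T(2,1) V(2)[OF \<open>V \<in> \<V>\<close>] \<open>e \<in> V\<close>])
    have sub: "V \<subseteq> topspace E" "T \<subseteq> topspace X"
      using V(2) \<open>V \<in> \<V>\<close> T(2) openin_subset by auto
    note h = hom[OF \<open>V \<in> \<V>\<close>, unfolded homeomorphic_maps_def]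
    show "p ` V \<subseteq> T" using V(1) \<open>V \<in> \<V>\<close> by blast
    show "continuous_map (subtopology X T) (subtopology E V) (\<sigma> V)" using h by blast
    show "p (\<sigma> V x) = x" if "x \<in> T" for x using h that sub by auto
    show "\<sigma> V (p v) = v" if "v \<in> V" for v using h that sub by auto
    show "homeomorphic_map (subtopology E V) (subtopology X T) p"
      using hom[OF \<open>V \<in> \<V>\<close>] homeomorphic_map_maps by blast
  qed
qed

text \<open>Agreement of the two lifts is locally constant. Near a point each lift stays in one
  sheet: if the sheets coincide, injectivity of \<open>p\<close> there forces agreement; if they
  differ, they are disjoint and the lifts disagree. Both \<open>A\<close> and \<open>B\<close> are
  thus open, and connectedness excludes that both are nonempty.\<close>

lemma covering_unique_lift:
  assumes cov: "covering_projection E p X" and Z: "connected_space Z"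
    and f: "continuous_map Z E f" and g: "continuous_map Z E g"
    and eq: "\<And>z. z \<in> topspace Z \<Longrightarrow> p (f z) = p (g z)"
    and z0: "z0 \<in> topspace Z" "f z0 = g z0" and z: "z \<in> topspace Z"
  shows "f z = g z"
proof (rule ccontr)
  assume ne: "f z \<noteq> g z"
  define A where "A = {z \<in> topspace Z. f z = g z}"
  define B where "B = {z \<in> topspace Z. f z \<noteq> g z}"
  have *: "\<exists>W. openin Z W \<and> y \<in> W \<and> W \<subseteq> {w. (f w = g w) = (f y = g y)}" if y: "y \<in> topspace Z" for y
  proof -
    have fg: "f y \<in> topspace E" "g y \<in> topspace E"
      using f g y by (auto simp: continuous_map_def)
    then have "p (f y) \<in> topspace X"
      using cov by (auto simp: covering_projection_def)
    obtain T \<V> \<sigma> where T: "p (f y) \<in> T" "openin X T"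
      and V: "\<Union>\<V> = {e \<in> topspace E. p e \<in> T}" "\<And>V. V \<in> \<V> \<Longrightarrow> openin E V" "pairwise disjnt \<V>"
      and hom: "\<And>V. V \<in> \<V> \<Longrightarrow> homeomorphic_maps (subtopology E V) (subtopology X T) p (\<sigma> V)"
      by (rule covering_sheets[OF cov \<open>p (f y) \<in> topspace X\<close>]) (rule that)
    have inj: "u = v" if "V \<in> \<V>" "u \<in> V" "v \<in> V" "p u = p v" for u v V
    proof -
      have "V \<subseteq> topspace E" using V(2) that openin_subset by auto
      then have "\<And>w. w \<in> V \<Longrightarrow> \<sigma> V (p w) = w"
        using hom[OF that(1)] by (auto simp: homeomorphic_maps_def)
      then show ?thesis using that by metis
    qed
    obtain Vf Vg where Vf: "Vf \<in> \<V>" "f y \<in> Vf" and Vg: "Vg \<in> \<V>" "g y \<in> Vg"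
      using V(1) T(1) fg eq[OF y] by (smt (verit) UnionE mem_Collect_eq)
    define W where "W = {w \<in> topspace Z. f w \<in> Vf} \<inter> {w \<in> topspace Z. g w \<in> Vg}"
    have "openin Z W" unfolding W_def
      using f g V(2) Vf Vg by (intro openin_Int openin_continuous_map_preimage) auto
    moreover have "y \<in> W" using y Vf Vg by (simp add: W_def)
    moreover have "(f w = g w) = (f y = g y)" if w: "w \<in> W" for w
    proof (cases "Vf = Vg")
      case True
      then have "f y = g y" "f w = g w"
        using inj[OF Vf(1)] Vf Vg w eq by (auto simp: W_def y)
      then show ?thesis by simp
    next
      case False
      then have "disjnt Vf Vg" using V(3) Vf Vg by (auto simp: pairwise_def)
      then show ?thesis using Vf Vg w by (auto simp: W_def disjnt_iff)
    qed
    ultimately show ?thesis by blast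
  qed
  have "openin Z {z \<in> topspace Z. (f z = g z) = b}" for b
  proof (subst openin_subopen, intro ballI)
    fix y assume y: "y \<in> {z \<in> topspace Z. (f z = g z) = b}"
    then have y': "y \<in> topspace Z" and b: "(f y = g y) = b" by auto
    obtain W where W: "openin Z W" "y \<in> W" "W \<subseteq> {w. (f w = g w) = b}"
      using *[OF y'] unfolding b by metis
    then show "\<exists>W. openin Z W \<and> y \<in> W \<and> W \<subseteq> {z \<in> topspace Z. (f z = g z) = b}"
      using openin_subset[OF W(1)] by (intro exI[of _ W]) auto
  qed
  from this[of True] this[of False] have "openin Z A" "openin Z B"
    by (simp_all add: A_def B_def)
  moreover have "A \<union> B = topspace Z" "A \<inter> B = {}" "A \<noteq> {}" "B \<noteq> {}"
    using z0 z ne by (auto simp: A_def B_def)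
  ultimately show False using Z unfolding connected_space_def by blast
qed

section \<open>Homotopy lifting over an arbitrary parameter space\<close>

lemma covering_local_homotopy_lift:
  fixes Z :: "'z topology" and F :: "'z \<times> real \<Rightarrow> 'a"
  assumes cov: "covering_projection E p X"
    and F: "continuous_map (prod_topology Z unit_interval) X F"
    and f: "continuous_map Z E f" "\<And>z. z \<in> topspace Z \<Longrightarrow> p (f z) = F (z, 0)"
    and z0: "z0 \<in> topspace Z"
  obtains M g where "openin Z M" "z0 \<in> M"
    "continuous_map (subtopology (prod_topology Z euclideanreal) (M \<times> {0..1})) E g"
    "\<And>z t. z \<in> M \<Longrightarrow> t \<in> {0..1} \<Longrightarrow> p (g (z, t)) = F (z, t)"
    "\<And>z. z \<in> M \<Longrightarrow> g (z, 0) = f z"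
proof -
  \<comment> \<open>Any lift given at time \<open>a\<close> extends over \<open>[a, b]\<close> after shrinking the neighbourhood of \<open>z0\<close>.
    The interval bisection rule \<open>Bolzano\<close> replaces a Lebesgue number argument.\<close>
  define P where "P a b \<longleftrightarrow> 0 \<le> a \<and> b \<le> 1 \<longrightarrow>
    (\<forall>M f. openin Z M \<and> z0 \<in> M \<and> continuous_map (subtopology Z M) E f \<and> (\<forall>z\<in>M. p (f z) = F (z, a)) \<longrightarrow>
      (\<exists>M' g. openin Z M' \<and> z0 \<in> M' \<and> M' \<subseteq> M \<and>
         continuous_map (subtopology (prod_topology Z euclideanreal) (M' \<times> {a..b})) E g \<and>
         (\<forall>z\<in>M'. \<forall>t\<in>{a..b}. p (g (z, t)) = F (z, t)) \<and> (\<forall>z\<in>M'. g (z, a) = f z)))" for a b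
  have "P 0 1"
    using zero_le_one
  proof (induction rule: Bolzano)
    fix a b c assume ab: "P a b" and bc: "P b c" and le: "a \<le> b" "b \<le> c"
    show "P a c"
      unfolding P_def
    proof (intro impI allI, elim conjE)
      fix M f assume "0 \<le> a" "c \<le> 1" and M: "openin Z M" "z0 \<in> M"
        "continuous_map (subtopology Z M) E f" "\<forall>z\<in>M. p (f z) = F (z, a)"
      from ab[unfolded P_def, rule_format, of M f] this le obtain M1 g1 where 1: "openin Z M1" "z0 \<in> M1" "M1 \<subseteq> M"
         "continuous_map (subtopology (prod_topology Z euclideanreal) (M1 \<times> {a..b})) E g1"
         "\<forall>z\<in>M1. \<forall>t\<in>{a..b}. p (g1 (z, t)) = F (z, t)" "\<forall>z\<in>M1. g1 (z, a) = f z"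
        by auto
      \<comment> \<open>The end of the first lift is the initial lift for the second interval, so
        the two pieces match at time \<open>b\<close>.\<close>
      have "continuous_map (subtopology Z M1) E (\<lambda>z. g1 (z, b))"
        by (rule continuous_map_compose[OF _ 1(4), of _ "\<lambda>z. (z, b)", unfolded o_def])
          (use le in \<open>auto simp: continuous_map_in_subtopology continuous_map_pairwise o_def
             continuous_map_from_subtopology\<close>)
      moreover have "\<forall>z\<in>M1. p (g1 (z, b)) = F (z, b)" using 1 le by auto
      ultimately have "\<exists>M2 g2. openin Z M2 \<and> z0 \<in> M2 \<and> M2 \<subseteq> M1 \<and>
         continuous_map (subtopology (prod_topology Z euclideanreal) (M2 \<times> {b..c})) E g2 \<and>
         (\<forall>z\<in>M2. \<forall>t\<in>{b..c}. p (g2 (z, t)) = F (z, t)) \<and> (\<forall>z\<in>M2. g2 (z, b) = g1 (z, b))"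
        using bc[unfolded P_def, rule_format, of M1 "\<lambda>z. g1 (z, b)"] 1 le \<open>0 \<le> a\<close> \<open>c \<le> 1\<close> by auto
      then obtain M2 g2 where 2: "openin Z M2" "z0 \<in> M2" "M2 \<subseteq> M1"
         "continuous_map (subtopology (prod_topology Z euclideanreal) (M2 \<times> {b..c})) E g2"
         "\<forall>z\<in>M2. \<forall>t\<in>{b..c}. p (g2 (z, t)) = F (z, t)" "\<forall>z\<in>M2. g2 (z, b) = g1 (z, b)"
        by blast
      define g where "g = (\<lambda>x. if snd x \<le> b then g1 x else g2 x)"
      have "continuous_map (subtopology (prod_topology Z euclideanreal) (M2 \<times> {a..c})) E g"
        unfolding g_def
      proof (rule continuous_map_cases_le)
        show "continuous_map (subtopology (prod_topology Z euclideanreal) (M2 \<times> {a..c})) euclideanreal snd"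
          by (simp add: continuous_map_from_subtopology continuous_map_snd)
        show "continuous_map (subtopology (subtopology (prod_topology Z euclideanreal) (M2 \<times> {a..c}))
            {x \<in> topspace (subtopology (prod_topology Z euclideanreal) (M2 \<times> {a..c})). snd x \<le> b}) E g1"
          unfolding subtopology_subtopology
          by (rule continuous_map_from_subtopology_mono[OF 1(4)]) (use 2 in auto)
        show "continuous_map (subtopology (subtopology (prod_topology Z euclideanreal) (M2 \<times> {a..c}))
            {x \<in> topspace (subtopology (prod_topology Z euclideanreal) (M2 \<times> {a..c})). b \<le> snd x}) E g2"
          unfolding subtopology_subtopology
          by (rule continuous_map_from_subtopology_mono[OF 2(4)]) auto
      qed (use 2 in auto)
      moreover have "\<forall>z\<in>M2. \<forall>t\<in>{a..c}. p (g (z, t)) = F (z, t)" "\<forall>z\<in>M2. g (z, a) = f z"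
        using 1 2 le by (auto simp: g_def)
      ultimately show "\<exists>M' g. openin Z M' \<and> z0 \<in> M' \<and> M' \<subseteq> M \<and>
         continuous_map (subtopology (prod_topology Z euclideanreal) (M' \<times> {a..c})) E g \<and>
         (\<forall>z\<in>M'. \<forall>t\<in>{a..c}. p (g (z, t)) = F (z, t)) \<and> (\<forall>z\<in>M'. g (z, a) = f z)"
        using 1(3) 2(1-3) by (intro exI[of _ M2] exI[of _ g]) auto
    qed
  next
    fix t :: real assume t: "0 \<le> t" "t \<le> 1"
    have "F (z0, t) \<in> topspace X" using F z0 t by (auto simp: continuous_map_def)
    obtain T \<V> \<sigma> where T: "F (z0, t) \<in> T" "openin X T"
      and V: "\<Union>\<V> = {e \<in> topspace E. p e \<in> T}" "\<And>V. V \<in> \<V> \<Longrightarrow> openin E V" "pairwise disjnt \<V>"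
      and hom: "\<And>V. V \<in> \<V> \<Longrightarrow> homeomorphic_maps (subtopology E V) (subtopology X T) p (\<sigma> V)"
      by (rule covering_sheets[OF cov \<open>F (z0, t) \<in> topspace X\<close>]) (rule that)
    define S where "S = {y \<in> topspace (prod_topology Z unit_interval). F y \<in> T}"
    have "openin (prod_topology Z unit_interval) S"
      unfolding S_def using F T(2) by (rule openin_continuous_map_preimage)
    moreover have "(z0, t) \<in> S"
      using z0 t T(1) by (simp add: S_def)
    ultimately have "\<exists>N J. openin Z N \<and> openin unit_interval J \<and> z0 \<in> N \<and> t \<in> J \<and> N \<times> J \<subseteq> S"
      by (simp add: openin_prod_topology_alt)
    then obtain N J where NJ: "openin Z N" "openin unit_interval J" "z0 \<in> N" "t \<in> J"
       "N \<times> J \<subseteq> S"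
      by (elim exE conjE)
    obtain d where "d > 0" "\<forall>s\<in>{0..1}. dist s t < d \<longrightarrow> s \<in> J"
      using NJ(2,4) unfolding openin_euclidean_subtopology_iff by metis
    then have d: "d > 0" "\<And>s. s \<in> {0..1} \<Longrightarrow> \<bar>s - t\<bar> < d \<Longrightarrow> s \<in> J"
      by (auto simp: dist_real_def)
    show "\<exists>d>0. \<forall>a b. a \<le> t \<and> t \<le> b \<and> b - a < d \<longrightarrow> P a b"
    proof (intro exI[of _ d] conjI allI impI d(1), elim conjE)
      fix a b assume ab: "a \<le> t" "t \<le> b" "b - a < d"
      show "P a b"
        unfolding P_def
      proof (intro impI allI, elim conjE)
        \<comment> \<open>The bisection rule also offers intervals around \<open>t\<close> that
          leave [0, 1]; the guard in \<open>P\<close> confines the claim to those on which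
          \<open>F\<close> is given.\<close>
        fix M f assume "0 \<le> a" "b \<le> 1" and M: "openin Z M" "z0 \<in> M"
          and f: "continuous_map (subtopology Z M) E f" "\<forall>z\<in>M. p (f z) = F (z, a)"
        have abJ: "{a..b} \<subseteq> J" using d(2) ab \<open>0 \<le> a\<close> \<open>b \<le> 1\<close> by auto
        have FT: "F (z, s) \<in> T" if "z \<in> N" "s \<in> {a..b}" for z s
        proof -
          have "(z, s) \<in> N \<times> J" using that abJ by blast
          then have "(z, s) \<in> S" using NJ(5) by blast
          then show ?thesis by (simp add: S_def)
        qed
        have MZ: "M \<subseteq> topspace Z" using M openin_subset by auto
        have "f z0 \<in> topspace E" using f M MZ by (auto simp: continuous_map_def)
        moreover have "p (f z0) \<in> T" using f M FT NJ(3) ab by auto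
        ultimately obtain V where VV: "V \<in> \<V>" "f z0 \<in> V" using V(1) by blast
        have VE: "V \<subseteq> topspace E" using V(2) VV openin_subset by auto
        \<comment> \<open>Over \<open>M'\<close> the initial lift lies in the single sheet
          \<open>V\<close>, and \<open>F\<close> maps \<open>M' \<times> {a..b}\<close> into
          \<open>T\<close>. Following \<open>F\<close> by the inverse of \<open>p\<close> on that
          sheet therefore continues the initial lift.\<close>
        define M' where "M' = {z \<in> M. f z \<in> V} \<inter> N"
        have "openin (subtopology Z M) {z \<in> topspace (subtopology Z M). f z \<in> V}"
          using f(1) V(2)[OF VV(1)] by (rule openin_continuous_map_preimage)
        moreover have "{z \<in> topspace (subtopology Z M). f z \<in> V} = {z \<in> M. f z \<in> V}"
          using MZ by auto
        ultimately have "openin Z {z \<in> M. f z \<in> V}"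
          using M(1) openin_trans_full by metis
        then have M': "openin Z M'" unfolding M'_def using NJ(1) by (rule openin_Int)
        have \<sigma>: "continuous_map (subtopology X T) (subtopology E V) (\<sigma> V)"
          "\<And>x. x \<in> T \<Longrightarrow> p (\<sigma> V x) = x" "\<And>v. v \<in> V \<Longrightarrow> \<sigma> V (p v) = v"
          using hom[OF VV(1)] VE openin_subset[OF T(2)] by (auto simp: homeomorphic_maps_def)
        have "continuous_map (subtopology (prod_topology Z euclideanreal) (M' \<times> {a..b})) X F"
        proof -
          have "continuous_map (subtopology (prod_topology Z euclideanreal) (topspace Z \<times> {0..1})) X F"
            using F by (simp add: subtopology_Times)
          then show ?thesis
            by (rule continuous_map_from_subtopology_mono)
              (use \<open>0 \<le> a\<close> \<open>b \<le> 1\<close> openin_subset[OF M'] in auto)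
        qed
        then have "continuous_map (subtopology (prod_topology Z euclideanreal) (M' \<times> {a..b})) (subtopology X T) F"
          using FT by (auto simp: continuous_map_in_subtopology M'_def)
        from continuous_map_compose[OF this \<sigma>(1)]
        have "continuous_map (subtopology (prod_topology Z euclideanreal) (M' \<times> {a..b})) E (\<sigma> V \<circ> F)"
          by (simp add: continuous_map_in_subtopology)
        moreover have "\<forall>z\<in>M'. \<forall>s\<in>{a..b}. p ((\<sigma> V \<circ> F) (z, s)) = F (z, s)"
          using \<sigma>(2) FT by (auto simp: M'_def)
        moreover have "\<forall>z\<in>M'. (\<sigma> V \<circ> F) (z, a) = f z"
          using \<sigma>(3) f(2) by (auto simp: M'_def simp flip: f(2))
        moreover have "z0 \<in> M'" "M' \<subseteq> M" using M NJ VV by (auto simp: M'_def)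
        ultimately show "\<exists>M' g. openin Z M' \<and> z0 \<in> M' \<and> M' \<subseteq> M \<and>
         continuous_map (subtopology (prod_topology Z euclideanreal) (M' \<times> {a..b})) E g \<and>
         (\<forall>z\<in>M'. \<forall>t\<in>{a..b}. p (g (z, t)) = F (z, t)) \<and> (\<forall>z\<in>M'. g (z, a) = f z)"
          using M' by (intro exI[of _ M'] exI[of _ "\<sigma> V \<circ> F"]) auto
      qed
    qed
  qed
  from this[unfolded P_def, rule_format, of "topspace Z" f] f z0 
  obtain M g where "openin Z M" "z0 \<in> M"
    "continuous_map (subtopology (prod_topology Z euclideanreal) (M \<times> {0..1})) E g"
    "\<forall>z\<in>M. \<forall>t\<in>{0..1}. p (g (z, t)) = F (z, t)" "\<forall>z\<in>M. g (z, 0) = f z"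
    by auto
  then show thesis
    by (intro that[of M g]) auto
qed

text \<open>The local lifts over tubes M x [0,1] agree on overlaps: over a common point z they are
  two lifts of one path with the same start, and {z} x [0,1] is connected whatever \<open>Z\<close>
  is. The tubes form an open cover, so the lifts can be pasted.\<close>

theorem covering_homotopy_lift:
  fixes Z :: "'z topology" and F :: "'z \<times> real \<Rightarrow> 'a"
  assumes cov: "covering_projection E p X"
    and F: "continuous_map (prod_topology Z unit_interval) X F"
    and f: "continuous_map Z E f" "\<And>z. z \<in> topspace Z \<Longrightarrow> p (f z) = F (z, 0)"
  obtains G where "continuous_map (prod_topology Z unit_interval) E G"
    "\<And>z t. z \<in> topspace Z \<Longrightarrow> t \<in> {0..1} \<Longrightarrow> p (G (z, t)) = F (z, t)"
    "\<And>z. z \<in> topspace Z \<Longrightarrow> G (z, 0) = f z"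
proof -
  have "\<forall>z0\<in>topspace Z. \<exists>M g. openin Z M \<and> z0 \<in> M \<and>
    continuous_map (subtopology (prod_topology Z euclideanreal) (M \<times> {0..1})) E g \<and>
    (\<forall>z\<in>M. \<forall>t\<in>{0..1}. p (g (z, t)) = F (z, t)) \<and> (\<forall>z\<in>M. g (z, 0) = f z)"
  proof
    fix z0 assume "z0 \<in> topspace Z"
    obtain M g where "openin Z M" "z0 \<in> M"
      "continuous_map (subtopology (prod_topology Z euclideanreal) (M \<times> {0..1})) E g"
      "\<And>z t. z \<in> M \<Longrightarrow> t \<in> {0..1} \<Longrightarrow> p (g (z, t)) = F (z, t)" "\<And>z. z \<in> M \<Longrightarrow> g (z, 0) = f z"
      by (rule covering_local_homotopy_lift[OF cov F f(1) _ \<open>z0 \<in> topspace Z\<close>], erule f(2)) (rule that)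
    then show "\<exists>M g. openin Z M \<and> z0 \<in> M \<and>
      continuous_map (subtopology (prod_topology Z euclideanreal) (M \<times> {0..1})) E g \<and>
      (\<forall>z\<in>M. \<forall>t\<in>{0..1}. p (g (z, t)) = F (z, t)) \<and> (\<forall>z\<in>M. g (z, 0) = f z)"
      by (intro exI[of _ M] exI[of _ g]) simp
  qed
  then obtain M g where Mg: "\<And>i. i \<in> topspace Z \<Longrightarrow> openin Z (M i) \<and> i \<in> M i \<and>
    continuous_map (subtopology (prod_topology Z euclideanreal) (M i \<times> {0..1})) E (g i) \<and>
    (\<forall>z\<in>M i. \<forall>t\<in>{0..1}. p (g i (z, t)) = F (z, t)) \<and> (\<forall>z\<in>M i. g i (z, 0) = f z)"
    by metis
  have cont: "continuous_map (subtopology (prod_topology Z unit_interval) (M i \<times> {0..1})) E (g i)"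
    if "i \<in> topspace Z" for i
  proof -
    have "subtopology (prod_topology Z unit_interval) (M i \<times> {0..1}) =
          subtopology (prod_topology Z euclideanreal) (M i \<times> {0..1})"
      by (simp add: subtopology_Times subtopology_subtopology)
    then show ?thesis using Mg[OF that] by simp
  qed
  have agree: "g i (z, t) = g j (z, t)"
    if i: "i \<in> topspace Z" "z \<in> M i" and j: "j \<in> topspace Z" "z \<in> M j" and t: "t \<in> {0..1}" for i j z t
  proof -
    have path: "continuous_map unit_interval E (\<lambda>t. g i (z, t))" if "i \<in> topspace Z" "z \<in> M i" for i
    proof -
      have "z \<in> topspace Z" using Mg that openin_subset by blast
      then show ?thesis
        by (intro continuous_map_compose[OF _ cont[OF that(1)], of _ "\<lambda>t. (z, t)", unfolded o_def])
          (use that in \<open>auto simp: continuous_map_in_subtopology continuous_map_pairwise o_def\<close>)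
    qed
    show ?thesis
      by (rule covering_unique_lift[OF cov _ path[OF i] path[OF j], of 0])
        (use Mg[OF i(1)] Mg[OF j(1)] i j t in \<open>auto simp: connected_space_subtopology\<close>)
  qed
  obtain G where G: "continuous_map (prod_topology Z unit_interval) E G"
    "\<And>x i. \<lbrakk>i \<in> topspace Z; x \<in> topspace (prod_topology Z unit_interval) \<inter> M i \<times> {0..1}\<rbrakk> \<Longrightarrow> G x = g i x"
  proof (rule pasting_lemma_exists[where I = "topspace Z" and T = "\<lambda>i. M i \<times> {0..1}" and f = g])
    show "topspace (prod_topology Z unit_interval) \<subseteq> (\<Union>i\<in>topspace Z. M i \<times> {0..1})"
      using Mg by auto
    show "openin (prod_topology Z unit_interval) (M i \<times> {0..1})" if "i \<in> topspace Z" for i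
      using Mg[OF that] by (simp add: openin_prod_Times_iff)
    show "continuous_map (subtopology (prod_topology Z unit_interval) (M i \<times> {0..1})) E (g i)"
      if "i \<in> topspace Z" for i using that by (rule cont)
    show "g i x = g j x"
      if "i \<in> topspace Z" "j \<in> topspace Z"
        "x \<in> topspace (prod_topology Z unit_interval) \<inter> M i \<times> {0..1} \<inter> M j \<times> {0..1}" for i j x
      using agree[of i "fst x" j "snd x"] that by (cases x) simp
  qed (rule that)
  show thesis
  proof (rule that[OF G(1)])
    fix z assume z: "z \<in> topspace Z"
    then have "G (z, t) = g z (z, t)" if "t \<in> {0..1}" for t
      using G(2)[of z "(z, t)"] Mg that by auto
    then show "p (G (z, t)) = F (z, t)" if "t \<in> {0..1}" for t using Mg z that by auto
    show "G (z, 0) = f z" using \<open>\<And>t. t \<in> {0..1} \<Longrightarrow> G (z, t) = g z (z, t)\<close> Mg z by auto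
  qed
qed

text \<open>A path is a homotopy of maps from a one-point space.\<close>

lemma covering_path_lift:
  assumes cov: "covering_projection E p X" and \<alpha>: "pathin X \<alpha>" and e: "e \<in> topspace E" "p e = \<alpha> 0"
  obtains \<gamma> where "pathin E \<gamma>" "\<gamma> 0 = e" "\<And>t. t \<in> {0..1} \<Longrightarrow> p (\<gamma> t) = \<alpha> t"
proof -
  let ?Z = "discrete_topology {()}"
  have "continuous_map (prod_topology ?Z unit_interval) X (\<alpha> \<circ> snd)"
    using \<alpha> unfolding pathin_def by (intro continuous_map_compose[OF continuous_map_snd])
  then obtain G where G: "continuous_map (prod_topology ?Z unit_interval) E G"
    "\<And>z t. z \<in> topspace ?Z \<Longrightarrow> t \<in> {0..1} \<Longrightarrow> p (G (z, t)) = (\<alpha> \<circ> snd) (z, t)"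
    "\<And>z. z \<in> topspace ?Z \<Longrightarrow> G (z, 0) = e"
    using covering_homotopy_lift[OF cov, of ?Z "\<alpha> \<circ> snd" "\<lambda>_. e"] e by auto
  show thesis
  proof (rule that[of "G \<circ> Pair ()"])
    show "pathin E (G \<circ> Pair ())"
      unfolding pathin_def using G(1) by (rule continuous_map_o_Pair) simp
  qed (use G in auto)
qed

lemma covering_path_lift_unique:
  assumes cov: "covering_projection E p X" and "pathin E \<gamma>" "pathin E \<delta>" "\<gamma> 0 = \<delta> 0"
    and "\<And>t. t \<in> {0..1} \<Longrightarrow> p (\<gamma> t) = p (\<delta> t)" and "t \<in> {0..1}"
  shows "\<gamma> t = \<delta> t"
  by (rule covering_unique_lift[OF cov, of unit_interval _ _ 0])
    (use assms in \<open>auto simp: pathin_def connected_space_subtopology\<close>)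

lemma path_homotopic_iff:
  "path_homotopic X \<alpha> \<beta> \<longleftrightarrow>
     (\<exists>h. continuous_map (prod_topology unit_interval unit_interval) X h \<and>
        (\<forall>t\<in>{0..1}. h (0, t) = \<alpha> t) \<and> (\<forall>t\<in>{0..1}. h (1, t) = \<beta> t) \<and>
        (\<forall>s\<in>{0..1}. h (s, 0) = \<alpha> 0 \<and> h (s, 1) = \<alpha> 1))"
  unfolding path_homotopic_def by (subst homotopic_with) auto

text \<open>Lift the whole square, with the deformation parameter as parameter space and a constant
  initial lift. By uniqueness its two extreme vertical paths are \<open>\<gamma>\<close> and
  \<open>\<delta>\<close>.\<close>

lemma covering_lifts_of_homotopic_paths:
  assumes cov: "covering_projection E p X" and hom: "path_homotopic X \<alpha> \<beta>"
    and \<gamma>: "pathin E \<gamma>" "\<And>t. t \<in> {0..1} \<Longrightarrow> p (\<gamma> t) = \<alpha> t"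
    and \<delta>: "pathin E \<delta>" "\<And>t. t \<in> {0..1} \<Longrightarrow> p (\<delta> t) = \<beta> t"
    and start: "\<gamma> 0 = \<delta> 0"
  shows "\<gamma> 1 = \<delta> 1"
proof -
  obtain h where h: "continuous_map (prod_topology unit_interval unit_interval) X h"
    "\<And>t. t \<in> {0..1} \<Longrightarrow> h (0, t) = \<alpha> t" "\<And>t. t \<in> {0..1} \<Longrightarrow> h (1, t) = \<beta> t"
    "\<And>s. s \<in> {0..1} \<Longrightarrow> h (s, 0) = \<alpha> 0 \<and> h (s, 1) = \<alpha> 1"
    using hom unfolding path_homotopic_iff by blast
  have E0: "\<gamma> 0 \<in> topspace E" using \<gamma>(1) by (rule path_start_in_topspace)
  obtain G where G: "continuous_map (prod_topology unit_interval unit_interval) E G"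
    "\<And>s t. s \<in> {0..1} \<Longrightarrow> t \<in> {0..1} \<Longrightarrow> p (G (s, t)) = h (s, t)"
    "\<And>s. s \<in> {0..1} \<Longrightarrow> G (s, 0) = \<gamma> 0"
    using covering_homotopy_lift[OF cov h(1), of "\<lambda>_. \<gamma> 0"] E0 \<gamma>(2) h(4) by auto
  have vert: "pathin E (\<lambda>t. G (s, t))" if "s \<in> {0..1}" for s
    using continuous_map_o_Pair[OF G(1), of s] that by (simp add: pathin_def o_def)
  have "G (0, 1) = \<gamma> 1"
    by (rule covering_path_lift_unique[OF cov vert \<gamma>(1)]) (use G h \<gamma> in auto)
  moreover have "G (1, 1) = \<delta> 1"
    by (rule covering_path_lift_unique[OF cov vert \<delta>(1)]) (use G h \<delta> start in auto)
  \<comment> \<open>The edge at time 1 covers the constant path at \<open>\<alpha> 1\<close>, so by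
    uniqueness it is constant.\<close>
  moreover have "G (1, 1) = G (0, 1)"
  proof (rule covering_path_lift_unique[OF cov, of "\<lambda>s. G (s, 1)" "\<lambda>_. G (0, 1)"])
    show "pathin E (\<lambda>s. G (s, 1))"
      unfolding pathin_def
      by (rule continuous_map_compose[OF _ G(1), of _ "\<lambda>s. (s, 1)", unfolded o_def])
        (auto simp: continuous_map_pairwise o_def intro!: continuous_intros)
    then show "pathin E (\<lambda>_. G (0, 1))"
      using path_start_in_topspace by fastforce
  qed (use G h in auto)
  ultimately show ?thesis by simp
qed

section \<open>The fundamental group is a group\<close>

definition path_reverse :: "(real \<Rightarrow> 'a) \<Rightarrow> real \<Rightarrow> 'a" where
  "path_reverse \<alpha> = (\<lambda>t. \<alpha> (1 - t))"

section \<open>Path homotopies and the group laws up to homotopy\<close>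

lemma path_homotopic_imp_pathin:
  "path_homotopic X \<alpha> \<beta> \<Longrightarrow> pathin X \<alpha> \<and> pathin X \<beta>"
  unfolding path_homotopic_def pathin_def by (rule homotopic_with_imp_continuous_maps)

lemma path_homotopic_endpoints:
  "path_homotopic X \<alpha> \<beta> \<Longrightarrow> \<beta> 0 = \<alpha> 0 \<and> \<beta> 1 = \<alpha> 1"
  unfolding path_homotopic_def by (drule homotopic_with_imp_property) simp

lemma path_homotopic_refl: "pathin X \<alpha> \<Longrightarrow> path_homotopic X \<alpha> \<alpha>"
  by (simp add: path_homotopic_def pathin_def)

lemma path_homotopic_sym: "path_homotopic X \<alpha> \<beta> \<Longrightarrow> path_homotopic X \<beta> \<alpha>"
  using path_homotopic_endpoints[of X \<alpha> \<beta>]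
  by (simp add: path_homotopic_def homotopic_with_symD)

lemma path_homotopic_trans:
  "path_homotopic X \<alpha> \<beta> \<Longrightarrow> path_homotopic X \<beta> \<gamma> \<Longrightarrow> path_homotopic X \<alpha> \<gamma>"
  using path_homotopic_endpoints[of X \<alpha> \<beta>] homotopic_with_trans
  unfolding path_homotopic_def by fastforce

text \<open>The straight-line homotopy from \<open>\<phi>\<close> to \<open>\<psi>\<close> stays in
  the convex interval [0, 1] and is constant at both ends because the end values agree.
  Associativity, unit and inverse laws all compare two readings of one path and reduce to
  this.\<close>

lemma path_homotopic_reparam:
  assumes \<gamma>: "pathin X \<gamma>"
    and \<phi>: "continuous_on {0..1} \<phi>" "\<phi> ` {0..1} \<subseteq> {0..1}"
    and \<psi>: "continuous_on {0..1} \<psi>" "\<psi> ` {0..1} \<subseteq> {0..1}"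
    and ends: "\<phi> 0 = \<psi> 0" "\<phi> 1 = \<psi> 1"
    and \<alpha>: "\<And>t. t \<in> {0..1} \<Longrightarrow> \<alpha> t = \<gamma> (\<phi> t)" and \<beta>: "\<And>t. t \<in> {0..1} \<Longrightarrow> \<beta> t = \<gamma> (\<psi> t)"
  shows "path_homotopic X \<alpha> \<beta>"
proof -
  define \<theta> where "\<theta> = (\<lambda>x::real \<times> real. (1 - fst x) * \<phi> (snd x) + fst x * \<psi> (snd x))"
  have "\<theta> x \<in> {0..1}" if "x \<in> {0..1} \<times> {0..1}" for x
  proof -
    have "\<phi> (snd x) \<in> {0..1}" "\<psi> (snd x) \<in> {0..1}" "0 \<le> fst x" "fst x \<le> 1"
      using \<phi> \<psi> that by auto
    then show ?thesis
      using convexD_alt[of "{0..1::real}" "\<phi> (snd x)" "\<psi> (snd x)" "fst x"] by (simp add: \<theta>_def)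
  qed
  moreover have "continuous_on ({0..1} \<times> {0..1}) \<theta>"
    unfolding \<theta>_def
    by (intro continuous_intros continuous_on_compose2[OF \<phi>(1)] continuous_on_compose2[OF \<psi>(1)]) auto
  ultimately have "continuous_map (prod_topology unit_interval unit_interval) unit_interval \<theta>"
    unfolding prod_topology_subtopology_eu by (auto simp: image_subset_iff)
  then have "continuous_map (prod_topology unit_interval unit_interval) X (\<gamma> \<circ> \<theta>)"
    using \<gamma> unfolding pathin_def by (rule continuous_map_compose)
  then show ?thesis
    unfolding path_homotopic_iff
    by (intro exI[of _ "\<gamma> \<circ> \<theta>"]) (auto simp: \<theta>_def \<alpha> \<beta> ends algebra_simps)
qed

lemma path_homotopic_concat:
  assumes "path_homotopic X \<alpha> \<alpha>'" "path_homotopic X \<beta> \<beta>'" and meet: "\<alpha> 1 = \<beta> 0"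
  shows "path_homotopic X (path_concat \<alpha> \<beta>) (path_concat \<alpha>' \<beta>')"
proof -
  obtain h where h: "continuous_map (prod_topology unit_interval unit_interval) X h"
    "\<forall>t\<in>{0..1}. h (0, t) = \<alpha> t" "\<forall>t\<in>{0..1}. h (1, t) = \<alpha>' t"
    "\<forall>s\<in>{0..1}. h (s, 0) = \<alpha> 0 \<and> h (s, 1) = \<alpha> 1"
    using assms(1) unfolding path_homotopic_iff by metis
  obtain k where k: "continuous_map (prod_topology unit_interval unit_interval) X k"
    "\<forall>t\<in>{0..1}. k (0, t) = \<beta> t" "\<forall>t\<in>{0..1}. k (1, t) = \<beta>' t"
    "\<forall>s\<in>{0..1}. k (s, 0) = \<beta> 0 \<and> k (s, 1) = \<beta> 1"
    using assms(2) unfolding path_homotopic_iff by metis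
  define H where "H = (\<lambda>x::real \<times> real. if snd x \<le> 1/2 then h (fst x, 2 * snd x) else k (fst x, 2 * snd x - 1))"
  let ?Q = "prod_topology unit_interval unit_interval"
  have "continuous_map ?Q X H"
    unfolding H_def
  proof (rule continuous_map_cases_le)
    have "continuous_map ?Q euclideanreal (id \<circ> snd)"
      by (rule continuous_map_compose[OF continuous_map_snd]) (simp add: continuous_map_from_subtopology)
    then show "continuous_map ?Q euclideanreal snd" by simp
    show "continuous_map (subtopology ?Q {x \<in> topspace ?Q. snd x \<le> 1/2}) X (\<lambda>x. h (fst x, 2 * snd x))"
      by (rule continuous_map_compose[OF _ h(1), of _ "\<lambda>x. (fst x, 2 * snd x)", unfolded o_def])
        (auto simp: prod_topology_subtopology_eu subtopology_subtopology intro!: continuous_intros)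
    show "continuous_map (subtopology ?Q {x \<in> topspace ?Q. 1/2 \<le> snd x}) X (\<lambda>x. k (fst x, 2 * snd x - 1))"
      by (rule continuous_map_compose[OF _ k(1), of _ "\<lambda>x. (fst x, 2 * snd x - 1)", unfolded o_def])
        (auto simp: prod_topology_subtopology_eu subtopology_subtopology intro!: continuous_intros)
    \<comment> \<open>On the seam both squares show a constant edge, namely
      \<open>\<alpha> 1\<close> and \<open>\<beta> 0\<close>.\<close>
    show "h (fst x, 2 * snd x) = k (fst x, 2 * snd x - 1)" if "x \<in> topspace ?Q" "snd x = 1/2" for x
    proof -
      have "fst x \<in> {0..1}" using that by auto
      moreover have "2 * snd x = 1" using that(2) by simp
      ultimately show ?thesis using h(4) k(4) meet unfolding \<open>2 * snd x = 1\<close> by simp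
    qed
  qed simp
  then show ?thesis
    unfolding path_homotopic_iff
    by (intro exI[of _ H]) (use h k in \<open>auto simp: H_def path_concat_def\<close>)
qed

lemma pathin_concat:
  assumes "pathin X \<alpha>" "pathin X \<beta>" "\<alpha> 1 = \<beta> 0"
  shows "pathin X (path_concat \<alpha> \<beta>)"
  using path_homotopic_concat[OF path_homotopic_refl path_homotopic_refl] path_homotopic_imp_pathin assms
  by metis

lemma path_concat_endpoints [simp]:
  "path_concat \<alpha> \<beta> 0 = \<alpha> 0" "path_concat \<alpha> \<beta> 1 = \<beta> 1"
  by (simp_all add: path_concat_def)

lemma pathin_reverse: "pathin X \<alpha> \<Longrightarrow> pathin X (path_reverse \<alpha>)"
  unfolding pathin_def path_reverse_def
  by (erule continuous_map_compose[rotated, of _ _ _ _ "\<lambda>t. 1 - t", unfolded o_def])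
    (auto intro!: continuous_intros)

lemma path_reverse_endpoints [simp]:
  "path_reverse \<alpha> 0 = \<alpha> 1" "path_reverse \<alpha> 1 = \<alpha> 0"
  by (simp_all add: path_reverse_def)

text \<open>The change of parameter must carry the breakpoints 1/4 and 1/2 of the left bracketing to
  1/2 and 3/4. Its slopes 2, 1, 1/2 decrease, so it is concave and equals the minimum of its three
  affine pieces, which makes its continuity immediate.\<close>

lemma path_homotopic_assoc:
  assumes "pathin X \<alpha>" "pathin X \<beta>" "pathin X \<gamma>" "\<alpha> 1 = \<beta> 0" "\<beta> 1 = \<gamma> 0"
  shows "path_homotopic X (path_concat (path_concat \<alpha> \<beta>) \<gamma>) (path_concat \<alpha> (path_concat \<beta> \<gamma>))"
proof (rule path_homotopic_reparam[where \<phi> = "\<lambda>t. min (2 * t) (min (t + 1/4) (t / 2 + 1/2))" and \<psi> = "\<lambda>t. t"])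
  show "pathin X (path_concat \<alpha> (path_concat \<beta> \<gamma>))"
    using assms by (intro pathin_concat) auto
  fix t :: real assume "t \<in> {0..1}"
  consider "t \<le> 1/4" | "1/4 < t" "t \<le> 1/2" | "1/2 < t" by linarith
  then show "path_concat (path_concat \<alpha> \<beta>) \<gamma> t =
     path_concat \<alpha> (path_concat \<beta> \<gamma>) (min (2 * t) (min (t + 1/4) (t / 2 + 1/2)))"
    by cases (auto simp: path_concat_def min_def algebra_simps)
qed (auto intro!: continuous_intros)

lemma path_homotopic_left_unit:
  assumes "pathin X \<alpha>"
  shows "path_homotopic X (path_concat (\<lambda>_. \<alpha> 0) \<alpha>) \<alpha>"
proof (rule path_homotopic_reparam[OF assms, where \<phi> = "\<lambda>t. max 0 (2 * t - 1)" and \<psi> = "\<lambda>t. t"])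
  show "path_concat (\<lambda>_. \<alpha> 0) \<alpha> t = \<alpha> (max 0 (2 * t - 1))" for t
    by (cases "t \<le> 1/2") (simp_all add: path_concat_def max_absorb1 max_absorb2)
qed (auto intro!: continuous_intros)

text \<open>Going back and forth reads \<open>\<alpha>\<close> along |2t - 1|, which begins and ends
  at 1 and so deforms to the constant 1.\<close>

lemma path_homotopic_left_inverse:
  assumes "pathin X \<alpha>"
  shows "path_homotopic X (path_concat (path_reverse \<alpha>) \<alpha>) (\<lambda>_. \<alpha> 1)"
  by (rule path_homotopic_reparam[OF assms, where \<phi> = "\<lambda>t. \<bar>2 * t - 1\<bar>" and \<psi> = "\<lambda>_. 1"])
    (auto intro!: continuous_intros simp: path_concat_def path_reverse_def)

section \<open>Homotopy classes of loops as group elements\<close>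

lemma path_class_self: "pathin X \<alpha> \<Longrightarrow> \<alpha> \<in> path_class X \<alpha>"
  by (simp add: path_class_def path_homotopic_refl)

lemma path_class_eqI: "path_homotopic X \<alpha> \<beta> \<Longrightarrow> path_class X \<alpha> = path_class X \<beta>"
  unfolding path_class_def
  by (intro Collect_cong iffI) (erule (1) path_homotopic_trans[OF path_homotopic_sym] path_homotopic_trans)+

lemma loops_at_homotopic:
  "\<alpha> \<in> loops_at X x \<Longrightarrow> path_homotopic X \<alpha> \<beta> \<Longrightarrow> \<beta> \<in> loops_at X x"
  using path_homotopic_imp_pathin[of X \<alpha> \<beta>] path_homotopic_endpoints[of X \<alpha> \<beta>]
  by (simp add: loops_at_def)

lemma loops_at_concat: "\<alpha> \<in> loops_at X x \<Longrightarrow> \<beta> \<in> loops_at X x \<Longrightarrow> path_concat \<alpha> \<beta> \<in> loops_at X x"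
  by (auto simp: loops_at_def intro: pathin_concat)

lemma loops_at_reverse: "\<alpha> \<in> loops_at X x \<Longrightarrow> path_reverse \<alpha> \<in> loops_at X x"
  by (auto simp: loops_at_def intro: pathin_reverse)

text \<open>All sets in the union that defines the product coincide, since concatenation respects
  homotopy. The classes are nonempty, so the union is this common set rather than the empty
  set.\<close>

lemma fundamental_group_mult:
  assumes \<alpha>: "\<alpha> \<in> loops_at X x" and \<beta>: "\<beta> \<in> loops_at X x"
  shows "path_class X \<alpha> \<otimes>\<^bsub>fundamental_group X x\<^esub> path_class X \<beta> = path_class X (path_concat \<alpha> \<beta>)"
proof -
  have "path_class X (path_concat \<alpha>' \<beta>') = path_class X (path_concat \<alpha> \<beta>)"
    if "\<alpha>' \<in> path_class X \<alpha>" "\<beta>' \<in> path_class X \<beta>" for \<alpha>' \<beta>'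
    using that \<alpha> \<beta>
    by (intro path_class_eqI[symmetric] path_homotopic_concat) (auto simp: path_class_def loops_at_def)
  then have "path_class X \<alpha> \<otimes>\<^bsub>fundamental_group X x\<^esub> path_class X \<beta> =
      (\<Union>\<alpha>'\<in>path_class X \<alpha>. \<Union>\<beta>'\<in>path_class X \<beta>. path_class X (path_concat \<alpha> \<beta>))"
    unfolding fundamental_group_def monoid.simps by (intro SUP_cong refl)
  moreover have "path_class X \<alpha> \<noteq> {}" "path_class X \<beta> \<noteq> {}"
    using \<alpha> \<beta> by (auto simp: loops_at_def dest: path_class_self)
  ultimately show ?thesis by simp
qed

text \<open>This provides the trivial subgroup and the whole group as members of the lattice, where
  the extreme values are attained.\<close>

lemma group_fundamental_group:
  assumes "x \<in> topspace X"
  shows "group (fundamental_group X x)"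
proof (rule groupI)
  have carrier: "carrier (fundamental_group X x) = path_class X ` loops_at X x"
    and one: "\<one>\<^bsub>fundamental_group X x\<^esub> = path_class X (\<lambda>_. x)"
    by (simp_all add: fundamental_group_def)
  have const: "(\<lambda>_. x) \<in> loops_at X x" using assms by (simp add: loops_at_def)
  note simps = carrier one fundamental_group_mult loops_at_concat
  show "\<one>\<^bsub>fundamental_group X x\<^esub> \<in> carrier (fundamental_group X x)"
    using const by (simp add: simps)
  fix A assume "A \<in> carrier (fundamental_group X x)"
  then obtain \<alpha> where \<alpha>: "\<alpha> \<in> loops_at X x" "A = path_class X \<alpha>" by (auto simp: carrier)
  then have p\<alpha>: "pathin X \<alpha>" "\<alpha> 0 = x" "\<alpha> 1 = x" by (auto simp: loops_at_def)
  show "\<one>\<^bsub>fundamental_group X x\<^esub> \<otimes>\<^bsub>fundamental_group X x\<^esub> A = A"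
    using path_class_eqI[OF path_homotopic_left_unit[OF p\<alpha>(1)]] \<alpha> const p\<alpha> by (simp add: simps)
  have "path_class X (path_reverse \<alpha>) \<otimes>\<^bsub>fundamental_group X x\<^esub> A = \<one>\<^bsub>fundamental_group X x\<^esub>"
    using path_class_eqI[OF path_homotopic_left_inverse[OF p\<alpha>(1)]] \<alpha> p\<alpha> loops_at_reverse[OF \<alpha>(1)]
    by (simp add: simps)
  then show "\<exists>B\<in>carrier (fundamental_group X x). B \<otimes>\<^bsub>fundamental_group X x\<^esub> A = \<one>\<^bsub>fundamental_group X x\<^esub>"
    using loops_at_reverse[OF \<alpha>(1)] by (auto simp: carrier)
  fix B assume "B \<in> carrier (fundamental_group X x)"
  then obtain \<beta> where \<beta>: "\<beta> \<in> loops_at X x" "B = path_class X \<beta>" by (auto simp: carrier)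
  show "A \<otimes>\<^bsub>fundamental_group X x\<^esub> B \<in> carrier (fundamental_group X x)"
    using \<alpha> \<beta> by (simp add: simps)
  fix C assume "C \<in> carrier (fundamental_group X x)"
  then obtain \<gamma> where \<gamma>: "\<gamma> \<in> loops_at X x" "C = path_class X \<gamma>" by (auto simp: carrier)
  have "path_homotopic X (path_concat (path_concat \<alpha> \<beta>) \<gamma>) (path_concat \<alpha> (path_concat \<beta> \<gamma>))"
    using \<alpha> \<beta> \<gamma> by (intro path_homotopic_assoc) (auto simp: loops_at_def)
  then show "A \<otimes>\<^bsub>fundamental_group X x\<^esub> B \<otimes>\<^bsub>fundamental_group X x\<^esub> C =
     A \<otimes>\<^bsub>fundamental_group X x\<^esub> (B \<otimes>\<^bsub>fundamental_group X x\<^esub> C)"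
    using \<alpha> \<beta> \<gamma> path_class_eqI by (simp add: simps) 
qed

section \<open>Path spaces and pullback of sections\<close>

lemma topspace_path_space: "topspace (path_space X) = {\<alpha> \<in> extensional {0..1}. pathin X \<alpha>}"
proof -
  have "{\<alpha> \<in> extensional {0..1}. pathin X \<alpha>} \<in>
      {{\<alpha> \<in> extensional {0..1}. pathin X \<alpha> \<and> \<alpha> ` K \<subseteq> U} | K U. compact K \<and> K \<subseteq> {0..1} \<and> openin X U}"
    by (intro CollectI exI[of _ "{}"]) auto
  then show ?thesis
    unfolding path_space_def topology_generated_by_topspace by blast
qed

lemma openin_path_space:
  assumes "compact K" "K \<subseteq> {0..1}" "openin X U"
  shows "openin (path_space X) {\<alpha> \<in> extensional {0..1}. pathin X \<alpha> \<and> \<alpha> ` K \<subseteq> U}"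
  unfolding path_space_def
  by (rule topology_generated_by_Basis) (use assms in blast)

text \<open>Local compactness of [0, 1] is the reason: a path with \<open>\<alpha> t\<close> in
  \<open>U\<close> maps a compact neighbourhood \<open>K\<close> of \<open>t\<close> into
  \<open>U\<close>, and all paths doing the same form an open set.\<close>

lemma continuous_map_path_space_eval:
  "continuous_map (prod_topology (path_space X) unit_interval) X (\<lambda>y. fst y (snd y))"
  unfolding continuous_map_def
proof (intro conjI allI impI)
  let ?P = "prod_topology (path_space X) unit_interval"
  show "(\<lambda>y. fst y (snd y)) \<in> topspace ?P \<rightarrow> topspace X"
    by (auto simp: topspace_path_space pathin_def continuous_map_def)
  fix U assume U: "openin X U"
  show "openin ?P {y \<in> topspace ?P. fst y (snd y) \<in> U}"
    unfolding openin_prod_topology_alt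
  proof (intro allI impI)
    fix \<alpha> t assume "(\<alpha>, t) \<in> {y \<in> topspace ?P. fst y (snd y) \<in> U}"
    then have \<alpha>: "\<alpha> \<in> extensional {0..1}" "pathin X \<alpha>" "t \<in> {0..1}" "\<alpha> t \<in> U"
      by (auto simp: topspace_path_space)
    have "openin unit_interval {s \<in> topspace unit_interval. \<alpha> s \<in> U}"
      using \<alpha>(2) U unfolding pathin_def by (rule openin_continuous_map_preimage)
    then have "openin unit_interval {s \<in> {0..1}. \<alpha> s \<in> U}" by simp
    then obtain e where e: "e > 0" "\<forall>s\<in>{0..1}. dist s t < e \<longrightarrow> s \<in> {s \<in> {0..1}. \<alpha> s \<in> U}"
      unfolding openin_euclidean_subtopology_iff using \<alpha>(3,4) by blast
    \<comment> \<open>The radius e/2 keeps the closed ball inside the open e-ball, whose points in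
      [0, 1] are sent into \<open>U\<close>.\<close>
    define K where "K = {0..1} \<inter> cball t (e/2)"
    define N where "N = {\<beta> \<in> extensional {0..1}. pathin X \<beta> \<and> \<beta> ` K \<subseteq> U}"
    define J where "J = {0..1} \<inter> ball t (e/2)"
    have "openin (path_space X) N"
      unfolding N_def using U by (intro openin_path_space) (auto simp: K_def)
    moreover have "openin unit_interval J" unfolding J_def by (simp add: openin_open_Int)
    moreover have "\<alpha> \<in> N"
      using \<alpha> e by (auto simp: N_def K_def dist_commute)
    moreover have "t \<in> J" using \<alpha>(3) e(1) by (simp add: J_def)
    moreover have "N \<times> J \<subseteq> {y \<in> topspace ?P. fst y (snd y) \<in> U}"
      by (auto simp: N_def J_def K_def topspace_path_space image_subset_iff)
    ultimately show "\<exists>N J. openin (path_space X) N \<and> openin unit_interval J \<and> \<alpha> \<in> N \<and> t \<in> J \<and>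
        N \<times> J \<subseteq> {y \<in> topspace ?P. fst y (snd y) \<in> U}"
      by (intro exI[of _ N] exI[of _ J]) simp
  qed
qed

text \<open>For compact \<open>K\<close>, the tube lemma thickens {z} x K inside the open preimage
  of \<open>U\<close> to N x K, so a subbasic condition that holds at z holds on all of N. The
  restriction puts the path among the extensional functions.\<close>

lemma continuous_map_into_path_space:
  assumes H: "continuous_map (prod_topology Z unit_interval) X H"
  shows "continuous_map Z (path_space X) (\<lambda>z. restrict (\<lambda>t. H (z, t)) {0..1})"
proof -
  let ?h = "\<lambda>z. restrict (\<lambda>t. H (z, t)) {0..1}"
  have path: "pathin X (?h z)" if "z \<in> topspace Z" for z
  proof -
    have "continuous_map unit_interval X (H \<circ> Pair z)" using H that by (rule continuous_map_o_Pair)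
    then show ?thesis unfolding pathin_def by (rule continuous_map_eq) simp
  qed
  have preimage: "openin Z (?h -` {\<alpha> \<in> extensional {0..1}. pathin X \<alpha> \<and> \<alpha> ` K \<subseteq> U} \<inter> topspace Z)"
    if K: "compact K" "K \<subseteq> {0..1}" and U: "openin X U" for K U
  proof -
    have eq: "?h -` {\<alpha> \<in> extensional {0..1}. pathin X \<alpha> \<and> \<alpha> ` K \<subseteq> U} \<inter> topspace Z =
        {z \<in> topspace Z. \<forall>t\<in>K. H (z, t) \<in> U}" (is "_ = ?A")
      using path K(2) by (auto simp: image_subset_iff subset_iff)
    define W where "W = {y \<in> topspace (prod_topology Z unit_interval). H y \<in> U}"
    have W: "openin (prod_topology Z unit_interval) W"
      unfolding W_def using H U by (rule openin_continuous_map_preimage)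
    have "openin Z ?A"
    proof (subst openin_subopen, intro ballI)
      fix z assume z: "z \<in> ?A"
      have "compactin unit_interval K" using K by (simp add: compactin_subtopology)
      moreover have "{z} \<times> K \<subseteq> W" using z K(2) by (auto simp: W_def)
      ultimately obtain N J where NJ: "openin Z N" "z \<in> N" "K \<subseteq> J" "N \<times> J \<subseteq> W"
        using tube_lemma_right[OF W, of K z] z by auto
      then have "N \<times> K \<subseteq> W" by blast
      then have "N \<subseteq> ?A" using openin_subset[OF NJ(1)] by (auto simp: W_def)
      then show "\<exists>T. openin Z T \<and> z \<in> T \<and> T \<subseteq> ?A" using NJ(1,2) by (intro exI[of _ N]) simp
    qed
    then show ?thesis unfolding eq .
  qed
  show ?thesis
    unfolding path_space_def
  proof (rule continuous_on_generated_topo)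
    show "?h ` topspace Z \<subseteq> \<Union>{{\<alpha> \<in> extensional {0..1}. pathin X \<alpha> \<and> \<alpha> ` K \<subseteq> U} | K U.
        compact K \<and> K \<subseteq> {0..1} \<and> openin X U}"
      using path topspace_path_space[of X] unfolding path_space_def topology_generated_by_topspace
      by auto
  qed (use preimage in auto)
qed

text \<open>The path \<open>s'(q(e), x)\<close> of \<open>E'\<close> is projected to \<open>X\<close> and lifted to \<open>E\<close> starting at \<open>e\<close>.\<close>

lemma covering_pullback_section:
  fixes E :: "'e topology" and E' :: "'f topology" and X :: "'a topology"
  assumes cov: "covering_projection E p X" and cov': "continuous_map E' X p'"
    and q: "continuous_map E E' q" "\<And>e. e \<in> topspace E \<Longrightarrow> p' (q e) = p e"
    and s': "continuous_map (subtopology (prod_topology E' X) A') (path_space E') s'"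
      "\<And>b. b \<in> A' \<Longrightarrow> (s' b 0, p' (s' b 1)) = b"
    and A: "A \<subseteq> topspace (prod_topology E X)" "\<And>b. b \<in> A \<Longrightarrow> (q (fst b), snd b) \<in> A'"
  obtains s where "continuous_map (subtopology (prod_topology E X) A) (path_space E) s"
    "\<And>b. b \<in> A \<Longrightarrow> (s b 0, p (s b 1)) = b"
proof -
  define Z where "Z = subtopology (prod_topology E X) A"
  define m where "m = (\<lambda>b :: 'e \<times> 'a. (q (fst b), snd b))"
  have topZ: "topspace Z = A" using A(1) by (auto simp: Z_def)
  have fstZ: "continuous_map Z E fst" and sndZ: "continuous_map Z X snd"
    unfolding Z_def by (simp_all add: continuous_map_from_subtopology continuous_map_fst continuous_map_snd)
  have "continuous_map Z (prod_topology E' X) m"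
    unfolding m_def continuous_map_pairwise o_def fst_conv snd_conv
    using continuous_map_compose[OF fstZ q(1)] sndZ by (simp add: o_def)
  then have "continuous_map Z (subtopology (prod_topology E' X) A') m"
    using A(2) topZ by (auto simp: continuous_map_in_subtopology m_def)
  then have sm: "continuous_map Z (path_space E') (s' \<circ> m)"
    using s'(1) by (rule continuous_map_compose)
  have sm': "s' (m b) 0 = q (fst b)" "p' (s' (m b) 1) = snd b" if "b \<in> A" for b
    using s'(2)[OF A(2)[OF that]] by (auto simp: m_def)
  \<comment> \<open>Uncurrying the planner turns it into a homotopy in \<open>X\<close> parametrised
    by the piece \<open>A\<close>; it starts at \<open>p (fst z)\<close>, so \<open>fst\<close> is
    an initial lift.\<close>
  define F where "F = (\<lambda>y. p' ((s' (m (fst y))) (snd y)))"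
  have "continuous_map (prod_topology Z unit_interval) (prod_topology (path_space E') unit_interval)
      (\<lambda>y. ((s' \<circ> m) (fst y), snd y))"
    unfolding continuous_map_pairwise o_def fst_conv snd_conv
    by (intro conjI continuous_map_compose[OF continuous_map_fst sm, unfolded o_def] continuous_map_snd)
  from continuous_map_compose[OF continuous_map_compose[OF this continuous_map_path_space_eval] cov']
  have F: "continuous_map (prod_topology Z unit_interval) X F"
    by (simp add: F_def o_def)
  have F0: "p (fst z) = F (z, 0)" if "z \<in> topspace Z" for z
    using that sm'(1)[of z] q(2)[of "fst z"] A(1) topZ by (auto simp: F_def)
  obtain G where G: "continuous_map (prod_topology Z unit_interval) E G"
    "\<And>z t. z \<in> topspace Z \<Longrightarrow> t \<in> {0..1} \<Longrightarrow> p (G (z, t)) = F (z, t)"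
    "\<And>z. z \<in> topspace Z \<Longrightarrow> G (z, 0) = fst z"
    by (rule covering_homotopy_lift[OF cov F fstZ], erule F0) (rule that)
  show thesis
  proof (rule that[unfolded Z_def[symmetric]])
    show "continuous_map Z (path_space E) (\<lambda>z. restrict (\<lambda>t. G (z, t)) {0..1})"
      by (rule continuous_map_into_path_space[OF G(1)])
    fix b assume b: "b \<in> A"
    show "(restrict (\<lambda>t. G (b, t)) {0..1} 0, p (restrict (\<lambda>t. G (b, t)) {0..1} 1)) = b"
      using b G(2)[of b 1] G(3)[of b] sm'(2)[OF b] topZ by (simp add: F_def)
  qed
qed

text \<open>An open filtration that serves \<open>p'\<close> pulls back along q x id to one of the
  same length that serves \<open>p\<close>. So the infimum for \<open>p\<close> ranges over a larger
  set of lengths.\<close>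

lemma TC_map_le_of_covering:
  fixes E :: "'e topology" and E' :: "'f topology" and X :: "'a topology"
  assumes cov: "covering_projection E p X" and cov': "continuous_map E' X p'"
    and q: "continuous_map E E' q" "\<And>e. e \<in> topspace E \<Longrightarrow> p' (q e) = p e"
  shows "TC_map E p X \<le> TC_map E' p' X"
  unfolding TC_map_def sectional_number_def
proof (rule Inf_superset_mono, clarify)
  fix n and U' :: "nat \<Rightarrow> ('f \<times> 'a) set"
  assume U': "U' 0 = {}" "U' n = topspace (prod_topology E' X)"
    "\<forall>i\<le>n. openin (prod_topology E' X) (U' i)" "\<forall>i<n. U' i \<subseteq> U' (Suc i)"
    and s': "\<forall>i\<in>{1..n}. \<exists>s. continuous_map (subtopology (prod_topology E' X) (U' i - U' (i - 1))) (path_space E') s \<and>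
                (\<forall>b\<in>U' i - U' (i - 1). (s b 0, p' (s b 1)) = b)"
  define U where "U i = {b \<in> topspace (prod_topology E X). (q (fst b), snd b) \<in> U' i}" for i
  have "continuous_map (prod_topology E X) (prod_topology E' X) (\<lambda>b. (q (fst b), snd b))"
    unfolding continuous_map_pairwise o_def fst_conv snd_conv
    by (intro conjI continuous_map_compose[OF continuous_map_fst q(1), unfolded o_def] continuous_map_snd)
  then have "\<forall>i\<le>n. openin (prod_topology E X) (U i)"
    unfolding U_def using U'(3) by (intro allI impI openin_continuous_map_preimage) auto
  moreover have "U 0 = {}" using U'(1) by (simp add: U_def)
  moreover have "U n = topspace (prod_topology E X)"
    using U'(2) q(1) by (auto simp: U_def continuous_map_def)
  moreover have "\<forall>i<n. U i \<subseteq> U (Suc i)" using U'(4) by (auto simp: U_def)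
  moreover have "\<forall>i\<in>{1..n}. \<exists>s. continuous_map (subtopology (prod_topology E X) (U i - U (i - 1))) (path_space E) s \<and>
                (\<forall>b\<in>U i - U (i - 1). (s b 0, p (s b 1)) = b)"
  proof
    fix i assume "i \<in> {1..n}"
    then obtain t where t: "continuous_map (subtopology (prod_topology E' X) (U' i - U' (i - 1))) (path_space E') t"
       "\<And>b. b \<in> U' i - U' (i - 1) \<Longrightarrow> (t b 0, p' (t b 1)) = b"
      using s' by blast
    obtain s where "continuous_map (subtopology (prod_topology E X) (U i - U (i - 1))) (path_space E) s"
      "\<And>b. b \<in> U i - U (i - 1) \<Longrightarrow> (s b 0, p (s b 1)) = b"
    proof (rule covering_pullback_section[OF cov cov' q(1) _ t(1)])
      show "p' (q e) = p e" if "e \<in> topspace E" for e using that by (rule q(2))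
      show "(t b 0, p' (t b 1)) = b" if "b \<in> U' i - U' (i - 1)" for b using that by (rule t(2))
      show "U i - U (i - 1) \<subseteq> topspace (prod_topology E X)" by (auto simp: U_def)
      show "(q (fst b), snd b) \<in> U' i - U' (i - 1)" if "b \<in> U i - U (i - 1)" for b
        using that by (auto simp: U_def)
    qed (rule that)
    then show "\<exists>s. continuous_map (subtopology (prod_topology E X) (U i - U (i - 1))) (path_space E) s \<and>
                (\<forall>b\<in>U i - U (i - 1). (s b 0, p (s b 1)) = b)"
      by (intro exI[of _ s]) simp
  qed
  ultimately show "\<exists>m. enat n = enat m \<and> (\<exists>U. U 0 = {} \<and> U m = topspace (prod_topology E X) \<and>
      (\<forall>i\<le>m. openin (prod_topology E X) (U i)) \<and> (\<forall>i<m. U i \<subseteq> U (Suc i)) \<and>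
      (\<forall>i\<in>{1..m}. \<exists>s. continuous_map (subtopology (prod_topology E X) (U i - U (i - 1))) (path_space E) s \<and>
                (\<forall>b\<in>U i - U (i - 1). (s b 0, p (s b 1)) = b)))"
    by (intro exI[of _ n] exI[of _ U] conjI refl) simp_all
qed

section \<open>The lifting criterion and monotonicity\<close>

text \<open>The property is local and \<open>p\<close> maps a sheet homeomorphically to an open set
  of \<open>X\<close>: push the neighbourhood down, choose a path connected open set there, and
  bring it back by the section.\<close>

lemma covering_locally_path_connected:
  assumes cov: "covering_projection E p X" and X: "locally_path_connected_space X"
  shows "locally_path_connected_space E"
  unfolding locally_path_connected_space
proof clarify
  fix W e assume W: "openin E W" "e \<in> W"
  then have "e \<in> topspace E" using openin_subset by auto
  obtain T V \<sigma> where T: "openin X T" "p e \<in> T" "openin E V" "e \<in> V" "p ` V \<subseteq> T"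
    and \<sigma>: "continuous_map (subtopology X T) (subtopology E V) \<sigma>"
    "\<And>x. x \<in> T \<Longrightarrow> p (\<sigma> x) = x" "\<And>v. v \<in> V \<Longrightarrow> \<sigma> (p v) = v"
    and hom: "homeomorphic_map (subtopology E V) (subtopology X T) p"
    by (rule covering_local_section[OF cov \<open>e \<in> topspace E\<close>]) (rule that)
  have "openin (subtopology E V) (V \<inter> W)"
    using W(1) by (rule openin_subtopology_Int2)
  then have "openin (subtopology X T) (p ` (V \<inter> W))"
    using homeomorphic_imp_open_map[OF hom] by (simp add: open_map_def)
  then have "openin X (p ` (V \<inter> W))" using T(1) by (rule openin_trans_full)
  moreover have "p e \<in> p ` (V \<inter> W)" using T W by blast
  ultimately obtain U where U: "openin X U" "path_connectedin X U" "p e \<in> U" "U \<subseteq> p ` (V \<inter> W)"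
    using X[unfolded locally_path_connected_space] by meson
  have UT: "U \<subseteq> T" using U(4) T(5) by blast
  \<comment> \<open>As a preimage under \<open>p\<close> cut down to the sheet, the set is visibly
    open; as an image under \<sigma>, it is visibly path connected.\<close>
  have img: "\<sigma> ` U = {v \<in> V. p v \<in> U}"
  proof (intro subset_antisym subsetI)
    fix v assume "v \<in> \<sigma> ` U"
    then obtain w where "w \<in> V" "p w \<in> U" "v = \<sigma> (p w)" using U(4) by blast
    then show "v \<in> {v \<in> V. p v \<in> U}" using \<sigma>(3) by simp
  next
    fix v assume "v \<in> {v \<in> V. p v \<in> U}"
    then show "v \<in> \<sigma> ` U" using \<sigma>(3)[of v] by (metis (mono_tags) imageI mem_Collect_eq)
  qed
  have "V \<subseteq> topspace E" using T(3) by (rule openin_subset)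
  then have eq: "{v \<in> V. p v \<in> U} = {v \<in> topspace E. p v \<in> U} \<inter> V" by auto
  have "continuous_map E X p" using cov by (simp add: covering_projection_def)
  then have "openin E (\<sigma> ` U)"
    unfolding img eq using T(3) U(1) by (intro openin_Int openin_continuous_map_preimage)
  moreover have "path_connectedin E (\<sigma> ` U)"
  proof -
    have "continuous_map (subtopology X T) E \<sigma>"
      using \<sigma>(1) by (simp add: continuous_map_in_subtopology)
    moreover have "path_connectedin (subtopology X T) U"
      using U(2) UT by (simp add: path_connectedin_subtopology)
    ultimately show ?thesis by (rule path_connectedin_continuous_map_image)
  qed
  moreover have "e \<in> \<sigma> ` U" unfolding img using T(4) U(3) by simp
  moreover have "\<sigma> ` U \<subseteq> W" using U(4) \<sigma>(3) by fastforce
  ultimately show "\<exists>U. openin E U \<and> path_connectedin E U \<and> e \<in> U \<and> U \<subseteq> W"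
    by (intro exI[of _ "\<sigma> ` U"]) simp
qed

section \<open>The lifting criterion\<close>

lemma path_concat_comp: "f \<circ> path_concat \<alpha> \<beta> = path_concat (f \<circ> \<alpha>) (f \<circ> \<beta>)"
  by (auto simp: path_concat_def)

lemma path_concat_cong_on:
  assumes "\<And>t. t \<in> {0..1} \<Longrightarrow> \<alpha> t = \<alpha>' t" "\<And>t. t \<in> {0..1} \<Longrightarrow> \<beta> t = \<beta>' t" "t \<in> {0..1}"
  shows "path_concat \<alpha> \<beta> t = path_concat \<alpha>' \<beta>' t"
  using assms by (auto simp: path_concat_def)

text \<open>To find q(e), run from \<open>e0\<close> to \<open>e\<close>, map the path to
  \<open>X\<close>, lift it from \<open>b0\<close> and take the end point. The hypothesis on loops,
  which is the inclusion of the images of the fundamental groups, makes this independent of the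
  path.\<close>

lemma covering_lifting_criterion:
  fixes E :: "'e topology" and E' :: "'f topology" and X :: "'a topology"
  assumes cov: "covering_projection E' p X" and f: "continuous_map E X f"
    and E: "path_connected_space E" "locally_path_connected_space E"
    and base: "e0 \<in> topspace E" "b0 \<in> topspace E'" "p b0 = f e0"
    and loops: "\<And>\<gamma>. \<gamma> \<in> loops_at E e0 \<Longrightarrow> \<exists>\<delta>\<in>loops_at E' b0. path_homotopic X (f \<circ> \<gamma>) (p \<circ> \<delta>)"
  obtains q where "continuous_map E E' q" "\<And>e. e \<in> topspace E \<Longrightarrow> p (q e) = f e"
proof -
  define lifts where "lifts \<gamma> \<delta> \<longleftrightarrow> pathin E \<gamma> \<and> pathin E' \<delta> \<and> (\<forall>t\<in>{0..1}. p (\<delta> t) = f (\<gamma> t))"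
    for \<gamma> \<delta>
  \<comment> \<open>The construction is first a relation; \<open>R_ex\<close> and
    \<open>R_unique\<close> then show that it is the graph of a function on the space
    \<open>E\<close>.\<close>
  define R where "R e y \<longleftrightarrow> (\<exists>\<gamma> \<delta>. lifts \<gamma> \<delta> \<and> \<gamma> 0 = e0 \<and> \<gamma> 1 = e \<and> \<delta> 0 = b0 \<and> \<delta> 1 = y)" for e y
  have lifts_concat: "lifts (path_concat \<gamma> \<gamma>') (path_concat \<delta> \<delta>')"
    if "lifts \<gamma> \<delta>" "lifts \<gamma>' \<delta>'" "\<gamma> 1 = \<gamma>' 0" "\<delta> 1 = \<delta>' 0" for \<gamma> \<gamma>' \<delta> \<delta>'
    unfolding lifts_def
  proof (intro conjI ballI)
    show "p (path_concat \<delta> \<delta>' t) = f (path_concat \<gamma> \<gamma>' t)" if "t \<in> {0..1}" for t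
      using path_concat_cong_on[of "p \<circ> \<delta>" "f \<circ> \<gamma>" "p \<circ> \<delta>'" "f \<circ> \<gamma>'" t] that \<open>lifts \<gamma> \<delta>\<close> \<open>lifts \<gamma>' \<delta>'\<close>
      unfolding path_concat_comp[symmetric] by (simp add: lifts_def)
  qed (use that in \<open>auto simp: lifts_def intro: pathin_concat\<close>)
  have lift_ex: "\<exists>\<delta>. lifts \<gamma> \<delta> \<and> \<delta> 0 = b" if path: "pathin E \<gamma>" "b \<in> topspace E'" "p b = f (\<gamma> 0)" for \<gamma> b
  proof -
    have "pathin X (f \<circ> \<gamma>)" using path(1) f by (rule pathin_compose)
    moreover have "p b = (f \<circ> \<gamma>) 0" using path(3) by simp
    ultimately obtain \<delta> where "pathin E' \<delta>" "\<delta> 0 = b" "\<And>t. t \<in> {0..1} \<Longrightarrow> p (\<delta> t) = (f \<circ> \<gamma>) t"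
      by (rule covering_path_lift[OF cov _ path(2)]) (rule that)
    then show ?thesis using path(1) by (intro exI[of _ \<delta>]) (simp add: lifts_def)
  qed
  have R_ex: "\<exists>y. R e y" if e: "e \<in> topspace E" for e
  proof -
    obtain \<gamma> where \<gamma>: "pathin E \<gamma>" "\<gamma> 0 = e0" "\<gamma> 1 = e"
      using E(1)[unfolded path_connected_space_def, rule_format, OF base(1) e]
      by (elim exE conjE)
    then have "p b0 = f (\<gamma> 0)" using base(3) by simp
    from lift_ex[OF \<gamma>(1) base(2) this] obtain \<delta> where \<delta>: "lifts \<gamma> \<delta>" "\<delta> 0 = b0"
      by (elim exE conjE)
    then show ?thesis
      using \<gamma> unfolding R_def by (intro exI[of _ "\<delta> 1"] exI[of _ \<gamma>] exI[of _ \<delta>]) simp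
  qed
  have R_unique: "y = y'" if "R e y" "R e y'" for e y y'
  proof -
    obtain \<gamma> \<delta> where 1: "lifts \<gamma> \<delta>" "\<gamma> 0 = e0" "\<gamma> 1 = e" "\<delta> 0 = b0" "\<delta> 1 = y"
      using \<open>R e y\<close> unfolding R_def by (elim exE conjE)
    obtain \<gamma>' \<delta>' where 2: "lifts \<gamma>' \<delta>'" "\<gamma>' 0 = e0" "\<gamma>' 1 = e" "\<delta>' 0 = b0" "\<delta>' 1 = y'"
      using \<open>R e y'\<close> unfolding R_def by (elim exE conjE)
    have y: "y \<in> topspace E'" "p y = f e"
      using 1 path_finish_in_topspace[of E' \<delta>] by (auto simp: lifts_def)
    have rev: "pathin E (path_reverse \<gamma>')" using 2 by (simp add: lifts_def pathin_reverse)
    have "p y = f (path_reverse \<gamma>' 0)" using y(2) 2(3) by simp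
    from lift_ex[OF rev y(1) this] obtain \<eta> where \<eta>: "lifts (path_reverse \<gamma>') \<eta>" "\<eta> 0 = y"
      by (elim exE conjE)
    \<comment> \<open>The loop \<open>\<kappa>\<close> runs along \<open>\<gamma>\<close> and back along \<open>\<gamma>'\<close>. Its image is homotopic to the image of a
      loop \<open>\<mu>\<close> of \<open>E'\<close>, so its lift \<open>\<delta>\<close>, \<open>\<eta>\<close> closes up, and \<open>\<eta>\<close> reversed must be \<open>\<delta>'\<close>.\<close>
    define \<kappa> where "\<kappa> = path_concat \<gamma> (path_reverse \<gamma>')"
    have \<kappa>: "lifts \<kappa> (path_concat \<delta> \<eta>)"
      unfolding \<kappa>_def using 1 2 \<eta> by (intro lifts_concat) auto
    then have "\<kappa> \<in> loops_at E e0"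
      using 1 2 by (simp add: loops_at_def lifts_def \<kappa>_def)
    then obtain \<mu> where \<mu>: "\<mu> \<in> loops_at E' b0" "path_homotopic X (f \<circ> \<kappa>) (p \<circ> \<mu>)"
      using loops by blast
    have "path_concat \<delta> \<eta> 1 = \<mu> 1"
      by (rule covering_lifts_of_homotopic_paths[OF cov \<mu>(2)])
        (use \<kappa> \<mu>(1) 1 in \<open>auto simp: lifts_def loops_at_def\<close>)
    then have \<eta>1: "\<eta> 1 = b0" using \<mu>(1) by (simp add: loops_at_def)
    have "path_reverse \<eta> 1 = \<delta>' 1"
    proof (rule covering_path_lift_unique[OF cov])
      show "pathin E' (path_reverse \<eta>)" using \<eta>(1) by (simp add: lifts_def pathin_reverse)
      show "pathin E' \<delta>'" using 2(1) by (simp add: lifts_def)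
      show "path_reverse \<eta> 0 = \<delta>' 0" using \<eta>1 2(4) by simp
      show "p (path_reverse \<eta> t) = p (\<delta>' t)" if "t \<in> {0..1}" for t
      proof -
        have "p (\<eta> (1 - t)) = f (path_reverse \<gamma>' (1 - t))" using \<eta>(1) that by (simp add: lifts_def)
        moreover have "p (\<delta>' t) = f (\<gamma>' t)" using 2(1) that by (simp add: lifts_def)
        ultimately show ?thesis by (simp add: path_reverse_def)
      qed
    qed simp
    then show ?thesis using \<eta>(2) 2(5) by simp
  qed
  define q where "q e = (SOME y. R e y)" for e
  have Rq: "R e (q e)" if "e \<in> topspace E" for e
    unfolding q_def using R_ex[OF that] by (rule someI_ex)
  have R_eq: "R e y \<Longrightarrow> y \<in> topspace E' \<and> p y = f e" for e y
    by (auto simp: R_def lifts_def dest: path_finish_in_topspace)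
  have "\<exists>W. openin E W \<and> e \<in> W \<and> continuous_map (subtopology E W) E' q" if e: "e \<in> topspace E" for e
  proof -
    have qe: "q e \<in> topspace E'" "p (q e) = f e" using R_eq[OF Rq[OF e]] by auto
    obtain T V \<sigma> where T: "openin X T" "p (q e) \<in> T" "openin E' V" "q e \<in> V" "p ` V \<subseteq> T"
      and \<sigma>: "continuous_map (subtopology X T) (subtopology E' V) \<sigma>"
      "\<And>x. x \<in> T \<Longrightarrow> p (\<sigma> x) = x" "\<And>v. v \<in> V \<Longrightarrow> \<sigma> (p v) = v"
      "homeomorphic_map (subtopology E' V) (subtopology X T) p"
      by (rule covering_local_section[OF cov qe(1)]) (rule that)
    have "openin E {w \<in> topspace E. f w \<in> T}" using f T(1) by (rule openin_continuous_map_preimage)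
    moreover have "e \<in> {w \<in> topspace E. f w \<in> T}" using e T(2) qe(2) by simp
    ultimately obtain W where W: "openin E W" "path_connectedin E W" "e \<in> W" "W \<subseteq> {w \<in> topspace E. f w \<in> T}"
      using E(2)[unfolded locally_path_connected_space] by meson
    have "continuous_map (subtopology E W) (subtopology X T) f"
      using f W(4) by (auto simp: continuous_map_in_subtopology continuous_map_from_subtopology)
    from continuous_map_compose[OF this \<sigma>(1)]
    have cont: "continuous_map (subtopology E W) E' (\<sigma> \<circ> f)"
      by (simp add: continuous_map_in_subtopology)
    \<comment> \<open>Near \<open>e\<close> the map must be the local section after
      \<open>f\<close>: a path inside \<open>W\<close> from \<open>e\<close> to \<open>w\<close> has
      its lift in the sheet through \<open>q e\<close>, and appending it to a path that reaches
      \<open>e\<close> gives an admissible choice for \<open>w\<close>.\<close>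
    have eq: "(\<sigma> \<circ> f) w = q w" if w: "w \<in> topspace (subtopology E W)" for w
    proof -
      have "w \<in> W" "w \<in> topspace E" using w by auto
      then have "\<exists>\<eta>. pathin (subtopology E W) \<eta> \<and> \<eta> 0 = e \<and> \<eta> 1 = w"
        using W(2,3) e by (simp add: path_connectedin_def path_connected_space_def)
      then obtain \<eta> where \<eta>: "pathin (subtopology E W) \<eta>" "\<eta> 0 = e" "\<eta> 1 = w"
        by (elim exE conjE)
      have "pathin E' (\<sigma> \<circ> f \<circ> \<eta>)" using \<eta>(1) cont by (rule pathin_compose)
      moreover have "pathin E \<eta>" "\<forall>t\<in>{0..1}. \<eta> t \<in> W"
        using \<eta>(1) by (auto simp: pathin_subtopology)
      moreover have "p ((\<sigma> \<circ> f) v) = f v" if "v \<in> W" for v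
        using \<sigma>(2) W(4) that by auto
      ultimately have lift: "lifts \<eta> (\<sigma> \<circ> f \<circ> \<eta>)"
        by (simp add: lifts_def)
      obtain \<gamma> \<delta> where \<gamma>\<delta>: "lifts \<gamma> \<delta>" "\<gamma> 0 = e0" "\<gamma> 1 = e" "\<delta> 0 = b0" "\<delta> 1 = q e"
        using Rq[OF e] unfolding R_def by (elim exE conjE)
      moreover have "(\<sigma> \<circ> f \<circ> \<eta>) 0 = q e" using \<eta>(2) \<sigma>(3)[OF T(4)] qe(2) by simp
      ultimately have "lifts (path_concat \<gamma> \<eta>) (path_concat \<delta> (\<sigma> \<circ> f \<circ> \<eta>))"
        using lift \<eta>(2) by (intro lifts_concat) auto
      then have "R w ((\<sigma> \<circ> f) w)"
        unfolding R_def
        by (intro exI[of _ "path_concat \<gamma> \<eta>"] exI[of _ "path_concat \<delta> (\<sigma> \<circ> f \<circ> \<eta>)"])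
          (simp add: \<eta> \<gamma>\<delta>)
      then show ?thesis using Rq[OF \<open>w \<in> topspace E\<close>] by (rule R_unique)
    qed
    show ?thesis
      using W(1,3) continuous_map_eq[OF cont eq] by (intro exI[of _ W]) simp
  qed
  then obtain W where W: "\<And>e. e \<in> topspace E \<Longrightarrow> openin E (W e) \<and> e \<in> W e \<and> continuous_map (subtopology E (W e)) E' q"
    by metis
  have "continuous_map E E' q"
    by (rule pasting_lemma[where I = "topspace E" and T = W and f = "\<lambda>_. q"]) (use W in auto)
  then show thesis using R_eq[OF Rq] by (intro that[of q]) auto
qed

text \<open>Converts the inclusion of subgroups, which are sets of classes, into the statement about
  individual loops that the lifting criterion asks for.\<close>

lemma covering_for_subgroup_loops:
  assumes E: "covering_for_subgroup E e0 p X x0 G" and E': "covering_for_subgroup E' b0 p' X x0 G'"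
    and "G \<subseteq> G'" and \<gamma>: "\<gamma> \<in> loops_at E e0"
  shows "\<exists>\<delta>\<in>loops_at E' b0. path_homotopic X (p \<circ> \<gamma>) (p' \<circ> \<delta>)"
proof -
  have p: "continuous_map E X p"
    using E by (simp add: covering_for_subgroup_def covering_projection_def)
  have path: "pathin E \<gamma>" using \<gamma> by (simp add: loops_at_def)
  have "induced_map X p (path_class E \<gamma>) \<in> G"
    using E \<gamma> by (auto simp: covering_for_subgroup_def fundamental_group_def)
  then have "induced_map X p (path_class E \<gamma>) \<in> induced_map X p' ` carrier (fundamental_group E' b0)"
    using \<open>G \<subseteq> G'\<close> E' unfolding covering_for_subgroup_def by blast
  then obtain \<delta>0 where \<delta>0: "\<delta>0 \<in> loops_at E' b0"
    "induced_map X p (path_class E \<gamma>) = induced_map X p' (path_class E' \<delta>0)"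
    by (auto simp: fundamental_group_def)
  have "p \<circ> \<gamma> \<in> induced_map X p (path_class E \<gamma>)"
    unfolding induced_map_def using path_class_self[OF path] path_class_self[OF pathin_compose[OF path p]] by blast
  \<comment> \<open>Since \<open>induced_map\<close> is a union over representatives, membership
    yields some \<open>\<delta>\<close> homotopic to \<open>\<delta>0\<close> rather than
    \<open>\<delta>0\<close> itself; it is again a loop at \<open>b0\<close>.\<close>
  then obtain \<delta> where "path_homotopic E' \<delta>0 \<delta>" "path_homotopic X (p' \<circ> \<delta>) (p \<circ> \<gamma>)"
    unfolding \<delta>0(2) by (auto simp: induced_map_def path_class_def)
  then show ?thesis using loops_at_homotopic[OF \<delta>0(1)] path_homotopic_sym by blast
qed

text \<open>The covering is only assumed connected. It inherits local path connectedness from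
  \<open>X\<close>, which makes it path connected, as the lifting criterion requires.\<close>

lemma TC_map_mono_subgroup:
  fixes E :: "'e topology" and E' :: "'f topology" and X :: "'a topology"
  assumes X: "locally_path_connected_space X"
    and E: "covering_for_subgroup E e0 p X x0 G" and E': "covering_for_subgroup E' b0 p' X x0 G'"
    and "G \<subseteq> G'"
  shows "TC_map E p X \<le> TC_map E' p' X"
proof -
  have cov: "covering_projection E p X" "covering_projection E' p' X" "connected_space E"
    "e0 \<in> topspace E" "b0 \<in> topspace E'" "p' b0 = p e0"
    using E E' by (auto simp: covering_for_subgroup_def)
  have lpc: "locally_path_connected_space E"
    using cov(1) X by (rule covering_locally_path_connected)
  then have pc: "path_connected_space E"
    using cov(3) path_connected_eq_connected_space by blast
  have cont: "continuous_map E X p" "continuous_map E' X p'"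
    using cov(1,2) by (simp_all add: covering_projection_def)
  obtain q where "continuous_map E E' q" "\<And>e. e \<in> topspace E \<Longrightarrow> p' (q e) = p e"
    by (rule covering_lifting_criterion[OF cov(2) cont(1) pc lpc cov(4-6)],
        erule covering_for_subgroup_loops[OF E E' \<open>G \<subseteq> G'\<close>]) (rule that)
  then show ?thesis by (rule TC_map_le_of_covering[OF cov(1) cont(2)])
qed

text \<open>Since \<open>TC X\<close> is by definition \<open>TC_map\<close> of the identity, this
  brings it into the range of \<open>TC_map_mono_subgroup\<close>. The whole space serves as the
  only sheet.\<close>

lemma covering_for_subgroup_id:
  assumes "connected_space X" "x0 \<in> topspace X"
  shows "covering_for_subgroup X x0 id X x0 (carrier (fundamental_group X x0))"
proof -
  have "covering_projection X id X"
    unfolding covering_projection_def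
  proof (intro conjI ballI)
    fix x assume "x \<in> topspace X"
    then show "\<exists>T. x \<in> T \<and> openin X T \<and> (\<exists>\<V>. \<Union>\<V> = {e \<in> topspace X. id e \<in> T} \<and> (\<forall>V\<in>\<V>. openin X V) \<and>
        pairwise disjnt \<V> \<and> (\<forall>V\<in>\<V>. homeomorphic_map (subtopology X V) (subtopology X T) id))"
      by (intro exI[of _ "topspace X"] conjI exI[of _ "{topspace X}"]) (simp_all add: homeomorphic_map_id)
  qed (simp_all add: continuous_map_id)
  moreover have "induced_map X id (path_class X \<alpha>) = path_class X \<alpha>" if "\<alpha> \<in> loops_at X x0" for \<alpha>
  proof -
    have "induced_map X id (path_class X \<alpha>) = (\<Union>\<beta>\<in>path_class X \<alpha>. path_class X \<alpha>)"
      unfolding induced_map_def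
      by (intro SUP_cong refl) (simp add: path_class_def[of X \<alpha>] path_class_eqI[symmetric])
    moreover have "\<alpha> \<in> path_class X \<alpha>" using that by (simp add: loops_at_def path_class_self)
    ultimately show ?thesis by auto
  qed
  ultimately show ?thesis
    using assms by (simp add: covering_for_subgroup_def fundamental_group_def image_image)
qed

theorem theorem4p16:
  fixes X :: "'a topology" and x0 :: 'a
    and E :: "(real \<Rightarrow> 'a) set set \<Rightarrow> 'b topology"
    and e0 :: "(real \<Rightarrow> 'a) set set \<Rightarrow> 'b"
    and p :: "(real \<Rightarrow> 'a) set set \<Rightarrow> 'b \<Rightarrow> 'a"
  defines "\<pi> \<equiv> fundamental_group X x0"
  defines "subgroups \<equiv> {G. subgroup G \<pi>}"
  defines "tc \<equiv> (\<lambda>G. TC_map (E G) (p G) X)"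
  assumes "path_connected_space X" and "metric_ANR X" and "CW_complex X"
    and "x0 \<in> topspace X"
    and "\<And>G. G \<in> subgroups \<Longrightarrow> covering_for_subgroup (E G) (e0 G) (p G) X x0 G"
  shows "mono_on subgroups tc \<and>
         (tc {\<one>\<^bsub>\<pi>\<^esub>} \<in> tc ` subgroups \<and> (\<forall>n \<in> tc ` subgroups. tc {\<one>\<^bsub>\<pi>\<^esub>} \<le> n)) \<and>
         (TC X \<in> tc ` subgroups \<and> (\<forall>n \<in> tc ` subgroups. n \<le> TC X))"
proof -
  note cov = assms(8)
  have lpc: "locally_path_connected_space X"
    using assms(5) by (rule metric_ANR_imp_locally_path_connected)
  have grp: "group \<pi>" unfolding \<pi>_def using assms(7) by (rule group_fundamental_group)
  have triv: "{\<one>\<^bsub>\<pi>\<^esub>} \<in> subgroups" and full: "carrier \<pi> \<in> subgroups"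
    using group.triv_subgroup[OF grp] group.subgroup_self[OF grp] by (simp_all add: subgroups_def)
  have id: "covering_for_subgroup X x0 id X x0 (carrier \<pi>)"
    unfolding \<pi>_def using path_connected_imp_connected_space[OF assms(4)] assms(7)
    by (rule covering_for_subgroup_id)
  have mono: "tc G \<le> tc H" if "G \<in> subgroups" "H \<in> subgroups" "G \<subseteq> H" for G H
    unfolding tc_def by (rule TC_map_mono_subgroup[OF lpc cov[OF that(1)] cov[OF that(2)] that(3)])
  have le_TC: "tc G \<le> TC X" if "G \<in> subgroups" for G
  proof -
    have "G \<subseteq> carrier \<pi>" using that by (simp add: subgroups_def subgroup.subset)
    then show ?thesis
      unfolding tc_def TC_def by (rule TC_map_mono_subgroup[OF lpc cov[OF that] id])
  qed
  \<comment> \<open>The family supplies its own covering for the whole group, on the type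
    \<open>'b\<close>; it shares its subgroup with the identity of \<open>X\<close>, so monotonicity
    also applies in this direction.\<close>
  have "TC X \<le> tc (carrier \<pi>)"
    unfolding tc_def TC_def by (rule TC_map_mono_subgroup[OF lpc id cov[OF full] order.refl])
  then have "TC X = tc (carrier \<pi>)" using le_TC[OF full] by (rule antisym)
  moreover have "tc {\<one>\<^bsub>\<pi>\<^esub>} \<le> tc G" if "G \<in> subgroups" for G
    using triv that by (rule mono) (use that in \<open>simp add: subgroups_def subgroup.one_closed\<close>)
  moreover have "mono_on subgroups tc" by (rule mono_onI) (rule mono)
  ultimately show ?thesis using triv full le_TC by auto
qed

end
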